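(* Let $n,\ell,t$ be integers with $1\leq t\leq n-2$ and $n+t+2\leq \ell$, and assume $(\ell,q)\neq(n+t+2,2)$ and $(\ell,q)\neq(n+t+3,2)$. Let $\mathcal{F}\subseteq{V\brack n,0}$ be a non-trivial $t$-intersecting family. Then: (i) If $1\leq t\leq \frac{n}{2}-1$, then $|\mathcal{F}|\leq q^{\ell(n-t)}-\prod_{j=1}^{n-t}(q^\ell-q^j)+q^{n-t}(q^t-1)$, with equality if and only if $\mathcal{F}=\mathcal{H}_1(X,M)$ for some $(t,0)$-subspace $X$ and $(n+1,1)$-subspace $M$ of $V$ with $X\subseteq M$. (ii) If $\frac{n}{2}-\frac{1}{2}\leq t\leq n-2$, then $|\mathcal{F}|\leq q^{\ell(n-t-1)}\theta_{t+2}-q^{\ell(n-t-2)+1}\theta_{t+1}$, with equality if and only if $\mathcal{F}=\{F\in{V\brack n,0}:\dim(F\cap Z)\ge t+1\}$ for some $(t+2,0)$-subspace $Z$ of $V$.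
   Context: Let $q$ be a prime power, $V$ an $(n+\ell)$-dimensional vector space over $\mathbb{F}_q$ and $W$ a fixed $\ell$-dimensional subspace of $V$. A subspace $P$ of $V$ has type $(m,s)$ (is an $(m,s)$-subspace) if $\dim P=m$ and $\dim(P\cap W)=s$. For a subspace $S$ of $V$, ${S\brack m,s}$ denotes the set of all $(m,s)$-subspaces of $V$ contained in $S$. $\theta_a=(q^a-1)/(q-1)$. A family $\mathcal{F}\subseteq{V\brack n,0}$ is $t$-intersecting if $\dim(A\cap B)\ge t$ for all $A,B\in\mathcal F$; it is non-trivial if $\dim(\bigcap_{F\in\mathcal F}F)<t$. For a $(t,0)$-subspace $X$ and an $(n+1,1)$-subspace $M$ with $X\subseteq M$, $\mathcal{H}_1(X,M)=\{F\in{V\brack n,0}: X\subseteq F,\ \dim(F\cap M)\ge t+1\}\cup{M\brack n,0}$. *)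

theory Defs
  imports Complex_Main "HOL-Library.Cardinality"
begin

text \<open>
  The field with \<open>q\<close> elements is a finite field type \<open>'a\<close> with \<open>q = CARD('a)\<close>; the ambient
  space \<open>V\<close> is the whole type \<open>'b\<close> of vectors, i.e. \<open>UNIV\<close>. The scalar multiplication and the
  distinguished subspace are the explicit parameters \<open>scale\<close> and \<open>W\<close>.
\<close>

definition theta :: "nat \<Rightarrow> nat \<Rightarrow> real" where
  "theta q a = (real q ^ a - 1) / (real q - 1)"

definition has_type ::
  "('a::field \<Rightarrow> 'b::ab_group_add \<Rightarrow> 'b) \<Rightarrow> 'b set \<Rightarrow> nat \<Rightarrow> nat \<Rightarrow> 'b set \<Rightarrow> bool" where
  "has_type scale W m s P \<longleftrightarrow>
     module.subspace scale P \<and> vector_space.dim scale P = m \<and> vector_space.dim scale (P \<inter> W) = s"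

definition subspaces_of_type ::
  "('a::field \<Rightarrow> 'b::ab_group_add \<Rightarrow> 'b) \<Rightarrow> 'b set \<Rightarrow> 'b set \<Rightarrow> nat \<Rightarrow> nat \<Rightarrow> 'b set set" where
  "subspaces_of_type scale W S m s = {P. has_type scale W m s P \<and> P \<subseteq> S}"

definition t_intersecting ::
  "('a::field \<Rightarrow> 'b::ab_group_add \<Rightarrow> 'b) \<Rightarrow> nat \<Rightarrow> 'b set set \<Rightarrow> bool" where
  "t_intersecting scale t \<F> \<longleftrightarrow> (\<forall>A\<in>\<F>. \<forall>B\<in>\<F>. t \<le> vector_space.dim scale (A \<inter> B))"

text \<open>For \<open>\<F> = {}\<close> the intersection is \<open>UNIV\<close>, so the empty family counts as trivial as soon
  as \<open>t\<close> is at most the dimension of \<open>V\<close>.\<close>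

definition nontrivial ::
  "('a::field \<Rightarrow> 'b::ab_group_add \<Rightarrow> 'b) \<Rightarrow> nat \<Rightarrow> 'b set set \<Rightarrow> bool" where
  "nontrivial scale t \<F> \<longleftrightarrow> vector_space.dim scale (\<Inter>\<F>) < t"

definition H1 ::
  "('a::field \<Rightarrow> 'b::ab_group_add \<Rightarrow> 'b) \<Rightarrow> 'b set \<Rightarrow> nat \<Rightarrow> nat \<Rightarrow> 'b set \<Rightarrow> 'b set \<Rightarrow> 'b set set" where
  "H1 scale W n t X M =
     {F \<in> subspaces_of_type scale W UNIV n 0. X \<subseteq> F \<and> t + 1 \<le> vector_space.dim scale (F \<inter> M)}
     \<union> subspaces_of_type scale W M n 0"

end

theory Submission
  imports Defs "HOL-Analysis.Infinite_Products"
begin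

text \<open>
  Call a subspace \<open>T\<close> with \<open>T \<inter> W = 0\<close> a cover of the family if every member meets it in dimension
  at least \<open>t\<close>. If \<open>X\<close> is not a cover, some member \<open>A\<close> meets it in dimension less than \<open>t\<close>, and then
  every member through \<open>X\<close> contains one of at most \<open>\<theta>\<^bsub>n-t+1\<^esub>\<close> subspaces of dimension \<open>dim X + 1\<close>
  containing \<open>X\<close>. Starting from the \<open>t\<close>-subspaces of a cover of least dimension \<open>\<tau>\<close> and iterating,
  one bounds the family; for \<open>\<tau> \<ge> t + 2\<close> the bound is below both extremal sizes.

  If \<open>\<tau> = t + 1\<close>, enlarge the family to a maximal one. Then the \<open>(t+1)\<close>-dimensional covers meet
  pairwise in dimension at least \<open>t\<close>, so they either lie in a common \<open>(t+2)\<close>-space \<open>Z\<close>, and all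
  members meet \<open>Z\<close> in dimension at least \<open>t + 1\<close>, or they share a \<open>t\<close>-space \<open>X\<close>. In the latter case
  all these covers lie in \<open>X + F\<close> for every member \<open>F\<close> not containing \<open>X\<close>. If \<open>X + F\<close> is always the
  same space \<open>M\<close>, the family is contained in \<open>H1 X M\<close>; otherwise there are at most \<open>\<theta>\<^bsub>n-t\<^esub>\<close> such
  covers, which is too few for an extremal family.
\<close>

section \<open>Subspaces of a finite-dimensional vector space\<close>

context finite_dimensional_vector_space
begin

lemmas span_subspace_eq [simp] = span_eq_iff [THEN iffD2]

lemma dim_Un_Int:
  assumes "subspace S" "subspace T"
  shows "dim (S \<union> T) + dim (S \<inter> T) = dim S + dim T"
proof -
  have "dim (S \<union> T) = dim (span (S \<union> T))"
    by simp
  also have "span (S \<union> T) = {x + y |x y. x \<in> S \<and> y \<in> T}"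
    using assms by (simp add: span_Un)
  finally show ?thesis
    using dim_sums_Int[OF assms] by simp
qed

lemma dim_add_le_dim_Int:
  assumes "subspace S" "subspace T" "S \<subseteq> U" "T \<subseteq> U"
  shows "dim S + dim T \<le> dim (S \<inter> T) + dim U"
proof -
  have "dim (S \<union> T) \<le> dim U"
    using assms by (intro dim_subset) auto
  then show ?thesis
    using dim_Un_Int[of S T] assms by simp
qed

lemma dim_eq_0_subspace: "subspace S \<Longrightarrow> dim S = 0 \<longleftrightarrow> S = {0}"
  using subspace_0[of S] by auto

lemma dim_span_insert: "subspace S \<Longrightarrow> v \<notin> S \<Longrightarrow> dim (span (insert v S)) = dim S + 1"
  by (simp add: dim_insert)

lemma span_insert_subset_iff: "subspace S \<Longrightarrow> span (insert v P) \<subseteq> S \<longleftrightarrow> v \<in> S \<and> P \<subseteq> S"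
  using span_minimal[of "insert v P" S] span_superset[of "insert v P"] by auto

lemma subset_span_insert: "P \<subseteq> span (insert v P)"
  using span_superset[of "insert v P"] by simp

lemma eq_span_insert_if_dim:
  assumes "subspace X" "subspace Y" "X \<subseteq> Y" "v \<in> Y" "v \<notin> X" "dim Y = dim X + 1"
  shows "Y = span (insert v X)"
  using subspace_dim_equal[of "span (insert v X)" Y] assms
  by (simp add: span_insert_subset_iff dim_insert)

lemma dim_less_dim_span_Un:
  assumes "subspace S" "\<not> X \<subseteq> S"
  shows "dim S < dim (X \<union> S)"
  by (rule dim_psubset) (use assms span_superset[of "X \<union> S"] in auto)

lemma span_insert_Int:
  assumes "subspace P" "subspace S" "v \<notin> span (P \<union> S)"
  shows "span (insert v P) \<inter> S = P \<inter> S"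
proof
  show "P \<inter> S \<subseteq> span (insert v P) \<inter> S"
    using subset_span_insert by blast
  show "span (insert v P) \<inter> S \<subseteq> P \<inter> S"
  proof
    fix x assume x: "x \<in> span (insert v P) \<inter> S"
    then obtain k where k: "x - scale k v \<in> P"
      using assms(1) span_breakdown_eq[of x v P] by auto
    have "x - (x - scale k v) \<in> span (P \<union> S)"
      using x k by (intro span_diff span_base) auto
    then have "scale (inverse k) (scale k v) \<in> span (P \<union> S)"
      by (intro span_scale [where x = "scale k v"]) simp
    then have "k = 0"
      using assms(3) by (cases "k = 0") auto
    then show "x \<in> P \<inter> S"
      using x k by simp
  qed
qed

lemma obtain_subspace_between:
  assumes "subspace X" "subspace Y" "X \<subseteq> Y" "dim X \<le> m" "m \<le> dim Y"
  obtains U where "subspace U" "X \<subseteq> U" "U \<subseteq> Y" "dim U = m"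
proof -
  have "\<exists>U. subspace U \<and> X \<subseteq> U \<and> U \<subseteq> Y \<and> dim U = m"
    using assms(4,5)
  proof (induction m rule: dec_induct)
    case base
    then show ?case using assms by auto
  next
    case (step m)
    then obtain U where U: "subspace U" "X \<subseteq> U" "U \<subseteq> Y" "dim U = m"
      by auto
    then obtain y where y: "y \<in> Y" "y \<notin> U"
      using step.prems by (metis not_less_eq_eq order_refl subsetI subset_antisym)
    have "span (insert y U) \<subseteq> Y" "dim (span (insert y U)) = Suc m" "X \<subseteq> span (insert y U)"
      using U y assms subset_span_insert[of U y] by (auto simp: span_insert_subset_iff dim_insert)
    then show ?case
      by (intro exI[of _ "span (insert y U)"]) simp
  qed
  then show ?thesis using that by blast
qed

lemma obtain_not_in_two_subspaces:
  assumes "subspace S" "subspace T" "S \<noteq> UNIV" "T \<noteq> UNIV"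
  obtains v where "v \<notin> S" "v \<notin> T"
proof (cases "S \<subseteq> T \<or> T \<subseteq> S")
  case True
  then show ?thesis using assms that by blast
next
  case False
  then obtain x y where "x \<in> S" "x \<notin> T" "y \<in> T" "y \<notin> S" by blast
  then have "x + y \<notin> S" "x + y \<notin> T"
    using assms subspace_diff[of S "x + y" x] subspace_diff[of T "x + y" y] by auto
  then show ?thesis by (rule that)
qed

text \<open>Take \<open>V = X + U\<close> with \<open>X \<inter> A \<subseteq> U \<subseteq> A\<close> and \<open>U\<close> large enough to meet \<open>F \<inter> A\<close> outside \<open>X\<close>.\<close>

lemma obtain_subspace_met_outside:
  assumes "subspace X" "subspace A" "dim (X \<inter> A) < t" "t \<le> dim A"
  obtains V where "subspace V" "X \<subseteq> V" "dim V = dim X + (dim A - t + 1)"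
    "\<And>F. subspace F \<Longrightarrow> t \<le> dim (F \<inter> A) \<Longrightarrow> \<not> F \<inter> V \<subseteq> X"
proof -
  let ?I = "X \<inter> A"
  have I: "subspace ?I"
    using assms by (intro subspace_inter)
  have "dim ?I \<le> dim A - t + dim ?I + 1" "dim A - t + dim ?I + 1 \<le> dim A"
    using assms(3,4) by linarith+
  then obtain U where U: "subspace U" "?I \<subseteq> U" "U \<subseteq> A" "dim U = dim A - t + dim ?I + 1"
    using obtain_subspace_between[OF I assms(2)] by blast
  show ?thesis
  proof (rule that[of "span (X \<union> U)"])
    have "X \<inter> U = ?I"
      using U by blast
    then show "dim (span (X \<union> U)) = dim X + (dim A - t + 1)"
      using dim_Un_Int[OF assms(1) U(1)] U(4) by simp
    fix F assume F: "subspace F" "t \<le> dim (F \<inter> A)"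
    have "subspace (F \<inter> A)"
      using F(1) assms(2) by (intro subspace_inter)
    then have "dim (F \<inter> A) + dim U \<le> dim (F \<inter> A \<inter> U) + dim A"
      using U by (intro dim_add_le_dim_Int) auto
    then have "dim ?I < dim (F \<inter> A \<inter> U)"
      using F(2) U(4) assms(4) by linarith
    then have "\<not> F \<inter> A \<inter> U \<subseteq> ?I"
      using dim_subset by (meson not_le)
    then show "\<not> F \<inter> span (X \<union> U) \<subseteq> X"
      using span_superset[of "X \<union> U"] by blast
  qed (use span_superset[of "X \<union> U"] in auto)
qed

lemma dim_Int_eq_if_neq:
  assumes "subspace T1" "subspace T2" "dim T1 = k + 1" "dim T2 = k + 1"
    and "k \<le> dim (T1 \<inter> T2)" "T1 \<noteq> T2"
  shows "dim (T1 \<inter> T2) = k"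
proof -
  have "\<not> T1 \<subseteq> T2"
    using subspace_dim_equal[of T1 T2] assms by auto
  moreover have "subspace (T1 \<inter> T2)"
    using assms by (intro subspace_inter)
  ultimately have "dim (T1 \<inter> T2) < k + 1"
    using subspace_dim_equal[of "T1 \<inter> T2" T1] assms by (auto simp: not_le)
  then show ?thesis using assms(5) by simp
qed

lemma subset_span_Un_if_meets_both:
  assumes T: "subspace T1" "subspace T2" "subspace T3" "dim T3 = k + 1"
    and meet: "dim (T1 \<inter> T2) = k" "k \<le> dim (T1 \<inter> T3)" "k \<le> dim (T2 \<inter> T3)"
    and not_subset: "\<not> T1 \<inter> T2 \<subseteq> T3"
  shows "T3 \<subseteq> span (T1 \<union> T2)"
proof -
  let ?S = "span (T1 \<inter> T3 \<union> T2 \<inter> T3)"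
  have sub: "subspace (T1 \<inter> T2)" "subspace (T1 \<inter> T3)" "subspace (T2 \<inter> T3)"
    using T by (auto intro: subspace_inter)
  have "\<not> T1 \<inter> T3 \<subseteq> T2 \<inter> T3"
  proof
    assume "T1 \<inter> T3 \<subseteq> T2 \<inter> T3"
    then have "T1 \<inter> T3 = T1 \<inter> T2"
      using sub meet by (intro subspace_dim_equal) auto
    then show False using not_subset by auto
  qed
  then have "dim T3 \<le> dim ?S"
    using dim_less_dim_span_Un[OF sub(3), of "T1 \<inter> T3"] meet T(4) by simp
  moreover have "?S \<subseteq> T3"
    using T by (intro span_minimal) auto
  ultimately have "?S = T3"
    using T by (intro subspace_dim_equal) auto
  moreover have "?S \<subseteq> span (T1 \<union> T2)"
    by (intro span_mono) auto
  ultimately show ?thesis by simp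
qed

lemma dim_Int_gt_if_meets_three:
  assumes sub: "subspace T1" "subspace T2" "subspace T3" "subspace F" "subspace Z"
    and le: "T1 \<subseteq> Z" "T2 \<subseteq> Z" "T3 \<subseteq> Z"
    and meet: "k \<le> dim (T1 \<inter> F)" "k \<le> dim (T2 \<inter> F)" "k \<le> dim (T3 \<inter> F)"
    and not_subset: "dim (T1 \<inter> T2) = k" "\<not> T1 \<inter> T2 \<subseteq> T3"
  shows "k < dim (F \<inter> Z)"
proof (rule ccontr)
  assume small: "\<not> k < dim (F \<inter> Z)"
  have FZ: "subspace (F \<inter> Z)"
    using sub by (intro subspace_inter)
  have Int_eq: "T \<inter> F = F \<inter> Z" if "subspace T" "T \<subseteq> Z" "k \<le> dim (T \<inter> F)" for T
    using that sub small FZ by (intro subspace_dim_equal) (auto intro: subspace_inter)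
  have "F \<inter> Z \<subseteq> T1 \<inter> T2" "k \<le> dim (F \<inter> Z)"
    using Int_eq[of T1] Int_eq[of T2] sub le meet by auto
  then have "F \<inter> Z = T1 \<inter> T2"
    using sub FZ not_subset by (intro subspace_dim_equal) (auto intro: subspace_inter)
  then show False
    using Int_eq[of T3] sub le meet not_subset by auto
qed

lemma subset_span_Un_if_meets_hyperplane:
  assumes "subspace X" "subspace T" "subspace F" "X \<subseteq> T" "dim T = dim X + 1"
    and "\<not> X \<subseteq> F" "dim X \<le> dim (T \<inter> F)"
  shows "T \<subseteq> span (X \<union> F)" "dim (X \<union> F) = dim F + 1"
proof -
  let ?S = "span (X \<union> T \<inter> F)"
  have TF: "subspace (T \<inter> F)"
    using assms by (intro subspace_inter)
  have "\<not> X \<subseteq> T \<inter> F"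
    using assms by blast
  then have less: "dim (T \<inter> F) < dim ?S"
    using dim_less_dim_span_Un[OF TF] by simp
  have sub: "?S \<subseteq> T"
    using assms by (intro span_minimal) auto
  then have "dim ?S \<le> dim T"
    by (rule dim_subset)
  then have dim: "dim (T \<inter> F) = dim X" "dim ?S = dim T"
    using less assms(5,7) by linarith+
  then have "?S = T"
    using sub assms by (intro subspace_dim_equal) auto
  moreover have "?S \<subseteq> span (X \<union> F)"
    by (intro span_mono) auto
  ultimately show "T \<subseteq> span (X \<union> F)"
    by simp
  have "X \<inter> (T \<inter> F) = X \<inter> F"
    using assms(4) by blast
  then have "dim X = dim (X \<inter> F) + 1"
    using dim_Un_Int[OF assms(1) TF] dim assms(5) by simp
  then show "dim (X \<union> F) = dim F + 1"
    using dim_Un_Int[OF assms(1,3)] by simp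
qed

lemma span_insert_coset:
  assumes "subspace P" "subspace W" "P \<inter> W = {0}" "v \<notin> span (P \<union> W)" "w \<in> W"
  shows "dim (span (insert (v + w) P)) = dim P + 1" "span (insert (v + w) P) \<inter> W = {0}"
proof -
  have notin: "v + w \<notin> span (P \<union> W)"
    using assms(4,5) span_add_eq2[of w "P \<union> W" v] span_base by blast
  then have "v + w \<notin> P"
    by (meson UnI1 span_base)
  then show "dim (span (insert (v + w) P)) = dim P + 1"
    using assms(1) by (rule dim_span_insert[rotated])
  show "span (insert (v + w) P) \<inter> W = {0}"
    using span_insert_Int[OF assms(1,2) notin] assms(3) by simp
qed

lemma dim_Int_span_Un:
  assumes "subspace W" "subspace M" "subspace P" "P \<subseteq> span (M \<union> W)"
  shows "dim (W \<inter> span (P \<union> M)) = dim P - dim (P \<inter> M) + dim (M \<inter> W)"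
proof -
  have "span (P \<union> M) \<subseteq> span (M \<union> W)"
    using assms(4) span_superset[of "M \<union> W"] by (intro span_minimal) auto
  then have "span (P \<union> M) \<union> W \<subseteq> span (M \<union> W)"
    using span_superset[of "M \<union> W"] by auto
  moreover have "M \<union> W \<subseteq> span (P \<union> M) \<union> W"
    using span_superset[of "P \<union> M"] by auto
  ultimately have "dim (span (P \<union> M) \<union> W) = dim (M \<union> W)"
    by (metis dim_span dim_subset le_antisym)
  moreover have "dim (span (P \<union> M) \<union> W) + dim (W \<inter> span (P \<union> M)) = dim (P \<union> M) + dim W"
    using dim_Un_Int[OF subspace_span assms(1), of "P \<union> M"] by (simp add: Int_commute)
  moreover have "dim (P \<inter> M) \<le> dim P"
    by (intro dim_subset) auto
  ultimately show ?thesis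
    using dim_Un_Int[OF assms(2,1)] dim_Un_Int[OF assms(3,2)] by linarith
qed

lemma add_notin_if_Int_eq:
  assumes "subspace P" "subspace M" "subspace F" "P \<subseteq> F" "F \<inter> M = P \<inter> M"
    and "v \<in> M" "v \<notin> span (P \<union> W)" "w \<in> W" "w \<in> span (P \<union> M)"
  shows "v + w \<notin> F"
proof
  assume vw: "v + w \<in> F"
  obtain p m where w: "w = p + m" "p \<in> P" "m \<in> M"
    using assms(1,2,9) by (auto simp: span_Un)
  have "v + m = (v + w) - p"
    using w(1) by simp
  also have "\<dots> \<in> F"
    using vw w(2) assms(3,4) by (auto intro: subspace_diff)
  finally have "v + m \<in> F \<inter> M"
    using w(3) assms(2,6) by (auto intro: subspace_add)
  then have "v + w \<in> P"
    using assms(5) subspace_add[OF assms(1) w(2), of "v + m"] w(1) by (auto simp: algebra_simps)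
  then have "(v + w) - w \<in> span (P \<union> W)"
    using assms(8) by (intro span_diff span_base) auto
  then show False
    using assms(7) by simp
qed

lemma span_insert_coset_Int:
  assumes "subspace P" "subspace M" "v \<in> M" "w \<notin> span (P \<union> M)"
  shows "span (insert (v + w) P) \<inter> M = P \<inter> M"
proof -
  have "v + w \<notin> span (P \<union> M)"
    using assms(3,4) span_add_eq[of v "P \<union> M" w] span_base by blast
  then show ?thesis
    using assms(1,2) by (intro span_insert_Int)
qed

end

section \<open>Gaussian numbers\<close>

locale gaussian_numbers =
  fixes q :: nat
  assumes q_ge_2: "2 \<le> q"
begin

abbreviation Q :: real where "Q \<equiv> real q"

abbreviation \<theta> :: "nat \<Rightarrow> real" where "\<theta> \<equiv> theta q"

definition gaussian_binomial :: "nat \<Rightarrow> nat \<Rightarrow> real" where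
  "gaussian_binomial m k = (\<Prod>j=1..k. \<theta> (m - k + j) / \<theta> j)"

lemma Q_ge_2: "2 \<le> Q"
  using q_ge_2 by simp

lemma theta_eq_sum: "\<theta> m = (\<Sum>i<m. Q ^ i)"
  using q_ge_2 by (simp add: theta_def geometric_sum)

lemma theta_mult: "\<theta> m * (Q - 1) = Q ^ m - 1"
  using q_ge_2 by (simp add: theta_def)

lemma theta_0 [simp]: "\<theta> 0 = 0"
  by (simp add: theta_def)

lemma theta_1 [simp]: "\<theta> (Suc 0) = 1"
  by (simp add: theta_eq_sum)

lemma theta_Suc: "\<theta> (Suc m) = \<theta> m + Q ^ m"
  by (simp add: theta_eq_sum)

lemma theta_Suc': "\<theta> (Suc m) = 1 + Q * \<theta> m"
  unfolding theta_eq_sum by (subst sum.lessThan_Suc_shift) (simp add: sum_distrib_left)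

lemma sum_powers_eq: "(\<Sum>j=1..m. Q ^ j) = Q * \<theta> m"
  by (induction m) (simp_all add: theta_Suc algebra_simps)

lemma theta_mono: "m \<le> k \<Longrightarrow> \<theta> m \<le> \<theta> k"
  unfolding theta_eq_sum by (intro sum_mono2) auto

lemma theta_nonneg: "0 \<le> \<theta> m"
  by (simp add: theta_eq_sum sum_nonneg)

lemma theta_ge_1: "1 \<le> m \<Longrightarrow> 1 \<le> \<theta> m"
  using theta_mono[of 1 m] by simp

lemma theta_mult_le: "\<theta> m * (Q - 1) \<le> Q ^ m"
  by (simp add: theta_mult)

lemma theta_le: "\<theta> m \<le> Q ^ m"
  using mult_left_mono[of 1 "Q - 1" "\<theta> m"] theta_mult_le[of m] theta_nonneg[of m] Q_ge_2 by simp

lemma power_le_theta_Suc: "Q ^ m \<le> \<theta> (Suc m)"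
  using theta_Suc[of m] theta_nonneg[of m] by simp

lemma theta_Suc_le: "1 \<le> m \<Longrightarrow> \<theta> (Suc m) \<le> (Q + 1) * \<theta> m"
  using theta_Suc'[of m] theta_ge_1[of m] by (simp add: algebra_simps)

lemma theta_add: "\<theta> (m + k) = \<theta> m + Q ^ m * \<theta> k"
  by (induction k) (simp_all add: theta_Suc power_add algebra_simps)

lemma theta_add_le:
  assumes "1 \<le> j"
  shows "\<theta> (t + j) \<le> \<theta> j * \<theta> (t + 1)"
proof -
  have "\<theta> (t + j) = \<theta> j + Q ^ j * \<theta> t"
    using theta_add[of j t] by (simp add: add.commute)
  also have "Q ^ j \<le> Q * \<theta> j"
    using assms power_le_theta_Suc[of "j - 1"] Q_ge_2 by (cases j) auto
  then have "Q ^ j * \<theta> t \<le> Q * \<theta> j * \<theta> t"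
    by (rule mult_right_mono) (rule theta_nonneg)
  also have "\<theta> j + Q * \<theta> j * \<theta> t = \<theta> j * \<theta> (t + 1)"
    using theta_Suc'[of t] by (simp add: algebra_simps)
  finally show ?thesis by simp
qed

lemma gaussian_binomial_nonneg: "0 \<le> gaussian_binomial m k"
  unfolding gaussian_binomial_def by (intro prod_nonneg ballI divide_nonneg_nonneg theta_nonneg)

lemma gaussian_binomial_add_Suc:
  "gaussian_binomial (t + Suc k) (Suc k)
    = gaussian_binomial (t + k) k * (\<theta> (t + Suc k) / \<theta> (Suc k))"
  by (simp add: gaussian_binomial_def)

lemma gaussian_binomial_1 [simp]: "gaussian_binomial (Suc m) (Suc 0) = \<theta> (Suc m)"
  by (simp add: gaussian_binomial_def)

lemma gaussian_binomial_absorb: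
  "gaussian_binomial (t + Suc k) (Suc k) * \<theta> (Suc k) = gaussian_binomial (t + Suc k) k * \<theta> (t + 1)"
proof -
  have "(\<Prod>j=1..Suc k. \<theta> (t + j)) = \<theta> (t + 1) * (\<Prod>j=1..k. \<theta> (t + Suc j))"
    by (induction k) simp_all
  moreover have "\<theta> (Suc k) \<noteq> 0"
    using theta_ge_1[of "Suc k"] by simp
  ultimately show ?thesis
    by (simp add: gaussian_binomial_def prod_dividef)
qed

end

section \<open>Counting subspaces over a finite field\<close>

lemma card_le_mult_of_relation:
  assumes "finite J" "finite A" "real (card J) \<le> c" "0 \<le> b"
    and "\<And>j. j \<in> J \<Longrightarrow> real (card {x \<in> A. R j x}) \<le> b"
    and "\<And>x. x \<in> A \<Longrightarrow> \<exists>j\<in>J. R j x"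
  shows "real (card A) \<le> c * b"
proof -
  have "A \<subseteq> (\<Union>j\<in>J. {x \<in> A. R j x})"
    using assms(6) by blast
  then have "card A \<le> card (\<Union>j\<in>J. {x \<in> A. R j x})"
    using assms by (intro card_mono) auto
  also have "\<dots> \<le> (\<Sum>j\<in>J. card {x \<in> A. R j x})"
    using assms(1) by (rule card_UN_le)
  finally have "real (card A) \<le> (\<Sum>j\<in>J. real (card {x \<in> A. R j x}))"
    by (simp flip: of_nat_sum)
  also have "\<dots> \<le> real (card J) * b"
    using assms(5) by (rule sum_bounded_above)
  also have "\<dots> \<le> c * b"
    using assms(3,4) by (rule mult_right_mono)
  finally show ?thesis .
qed

locale finite_field_vector_space = finite_dimensional_vector_space scale Basis
  for scale :: "'a::{field,finite} \<Rightarrow> 'b::ab_group_add \<Rightarrow> 'b" and Basis +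
  fixes q :: nat
  assumes card_field: "CARD('a) = q"
begin

sublocale gaussian_numbers q
proof
  have "card {0, 1 :: 'a} \<le> CARD('a)"
    by (rule card_mono) auto
  then show "2 \<le> q"
    by (simp add: card_field)
qed

definition subspaces_of_dim :: "'b set \<Rightarrow> nat \<Rightarrow> 'b set set" where
  "subspaces_of_dim S k = {U. subspace U \<and> U \<subseteq> S \<and> dim U = k}"

definition complements_in :: "'b set \<Rightarrow> 'b set \<Rightarrow> 'b set set" where
  "complements_in U W = {F. subspace F \<and> F \<subseteq> U \<and> F \<inter> W = {0} \<and> dim F + dim W = dim U}"

lemma span_insert_subset_complement_iff:
  "F \<in> complements_in U W \<Longrightarrow> span (insert v P) \<subseteq> F \<longleftrightarrow> P \<subseteq> F \<and> v \<in> F"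
  by (simp add: complements_in_def span_insert_subset_iff conj_commute)

lemma complements_in_UnE:
  assumes "subspace U" "subspace W" "W \<subseteq> U" "F \<in> complements_in U W" "v \<in> U"
  obtains x y where "v = x + y" "x \<in> F" "y \<in> W"
proof -
  have F: "subspace F" "F \<subseteq> U" "dim (F \<union> W) = dim U"
    using assms dim_Un_Int[of F W] by (auto simp: complements_in_def)
  then have "span (F \<union> W) = U"
    using assms by (intro subspace_dim_equal span_minimal) auto
  then have "v \<in> {x + y |x y. x \<in> F \<and> y \<in> W}"
    using assms(2,5) F by (simp add: span_Un)
  then show ?thesis using that by blast
qed

lemma card_complement_Int_coset:
  assumes "subspace U" "subspace W" "W \<subseteq> U" "F \<in> complements_in U W" "v \<in> U"
  shows "card {w \<in> W. v + w \<in> F} = 1"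
proof -
  obtain x y where v: "v = x + y" "x \<in> F" "y \<in> W"
    using complements_in_UnE[OF assms] .
  have F: "subspace F" "F \<inter> W = {0}"
    using assms by (auto simp: complements_in_def)
  have "w = - y" if w: "w \<in> W" "v + w \<in> F" for w
  proof -
    have "y + w \<in> F"
      using subspace_diff[OF F(1) w(2) v(2)] v(1) by (simp add: add.assoc)
    moreover have "y + w \<in> W"
      using v(3) w(1) assms(2) by (intro subspace_add)
    ultimately have "y + w = 0"
      using F(2) by blast
    then show ?thesis
      by (rule minus_unique [symmetric])
  qed
  moreover have "- y \<in> W" "v + - y \<in> F"
    using v subspace_neg[OF assms(2)] by simp_all
  ultimately have "{w \<in> W. v + w \<in> F} = {- y}"
    by blast
  then show ?thesis by simp
qed

lemma bij_betw_span_insert: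
  assumes "subspace S" "v \<notin> S"
  shows "bij_betw (\<lambda>(x, k). x + scale k v) (S \<times> UNIV) (span (insert v S))"
proof (rule bij_betw_imageI)
  have same_scalar: "k = k'" if "x \<in> S" "x' \<in> S" "x + scale k v = x' + scale k' v" for x x' k k'
  proof (rule ccontr)
    assume "k \<noteq> k'"
    have "scale (k - k') v = x' - x"
      using that(3) by (simp add: scale_left_diff_distrib algebra_simps)
    then have "scale (inverse (k - k')) (scale (k - k') v) \<in> S"
      using that assms(1) by (auto intro!: subspace_scale subspace_diff)
    then show False
      using \<open>k \<noteq> k'\<close> assms(2) by simp
  qed
  show "inj_on (\<lambda>(x, k). x + scale k v) (S \<times> UNIV)"
  proof (rule inj_onI, clarify)
    fix x k x' k' assume "x \<in> S" "x' \<in> S" and eq: "x + scale k v = x' + scale k' v"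
    then have "k = k'"
      by (rule same_scalar)
    then show "x = x' \<and> k = k'"
      using eq by simp
  qed
  show "(\<lambda>(x, k). x + scale k v) ` (S \<times> UNIV) = span (insert v S)"
  proof
    show "(\<lambda>(x, k). x + scale k v) ` (S \<times> UNIV) \<subseteq> span (insert v S)"
      by (auto intro!: span_add span_scale intro: span_base)
    show "span (insert v S) \<subseteq> (\<lambda>(x, k). x + scale k v) ` (S \<times> UNIV)"
    proof
      fix y assume "y \<in> span (insert v S)"
      then obtain k where "y - scale k v \<in> S"
        using assms(1) span_breakdown_eq[of y v S] by auto
      then show "y \<in> (\<lambda>(x, k). x + scale k v) ` (S \<times> UNIV)"
        by (intro image_eqI[of _ _ "(y - scale k v, k)"]) auto
    qed
  qed
qed

lemma card_span_independent:
  assumes "finite B" "independent B"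
  shows "finite (span B) \<and> card (span B) = q ^ card B"
  using assms
proof (induction B rule: finite_induct)
  case (insert v B)
  then have IH: "finite (span B)" "card (span B) = q ^ card B" and "v \<notin> span B"
    by (auto simp: independent_insert split: if_splits)
  then have "bij_betw (\<lambda>(x, k). x + scale k v) (span B \<times> UNIV) (span (insert v (span B)))"
    by (intro bij_betw_span_insert) auto
  also have "span (insert v (span B)) = span (insert v B)"
    by (simp add: span_insert span_span)
  finally have bij: "bij_betw (\<lambda>(x, k). x + scale k v) (span B \<times> UNIV) (span (insert v B))" .
  have "finite (span B \<times> (UNIV :: 'a set))" "card (span B \<times> (UNIV :: 'a set)) = q * q ^ card B"
    using IH by (simp_all add: card_cartesian_product card_field)
  then show ?case
    using bij_betw_finite[OF bij] bij_betw_same_card[OF bij] insert.hyps by simp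
qed simp

lemma card_subspace:
  assumes "subspace S"
  shows "card S = q ^ dim S"
proof -
  obtain B where "finite B" "independent B" "span B = S" "card B = dim S"
    using basis_subspace_exists[OF assms] .
  then show ?thesis
    using card_span_independent[of B] by simp
qed

lemma finite_vectors [simp]: "finite (A :: 'b set)"
  using card_span_independent[OF finite_Basis independent_Basis] rev_finite_subset[of UNIV A]
  by (simp add: span_Basis)

lemma finite_vector_sets [simp]: "finite (\<A> :: 'b set set)"
  by (meson finite_Pow_iff finite_subset finite_vectors subset_Pow_Union)

lemma card_Diff_subspace:
  assumes "subspace S" "subspace T" "S \<subseteq> T"
  shows "real (card (T - S)) = Q ^ dim T - Q ^ dim S"
proof -
  have "card S \<le> card T"
    using assms(3) by (intro card_mono) auto
  then show ?thesis
    using assms by (simp add: card_Diff_subset card_subspace of_nat_diff)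
qed

lemma card_extensions:
  assumes "subspace X" "subspace U" "X \<subseteq> U"
  shows "real (card {Y \<in> subspaces_of_dim U (dim X + 1). X \<subseteq> Y}) = \<theta> (dim U - dim X)"
proof -
  let ?\<Y> = "{Y \<in> subspaces_of_dim U (dim X + 1). X \<subseteq> Y}"
  have unique: "card {Y \<in> ?\<Y>. v \<in> Y} = 1" if v: "v \<in> U - X" for v
  proof -
    have "span (insert v X) \<in> ?\<Y>"
      using v assms subset_span_insert
      by (auto simp: subspaces_of_dim_def span_insert_subset_iff dim_insert)
    moreover have "Y = span (insert v X)" if "Y \<in> ?\<Y>" "v \<in> Y" for Y
      using that v assms by (intro eq_span_insert_if_dim) (auto simp: subspaces_of_dim_def)
    moreover have "v \<in> span (insert v X)"
      by (simp add: span_base)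
    ultimately have "{Y \<in> ?\<Y>. v \<in> Y} = {span (insert v X)}"
      by blast
    then show ?thesis by simp
  qed
  have "(\<Sum>Y\<in>?\<Y>. card {v \<in> U - X. v \<in> Y}) = 1 * card (U - X)"
    using unique by (intro sum_multicount) auto
  then have "(\<Sum>Y\<in>?\<Y>. real (card {v \<in> U - X. v \<in> Y})) = real (card (U - X))"
    by (simp flip: of_nat_sum)
  moreover have "real (card {v \<in> U - X. v \<in> Y}) = Q ^ dim X * (Q - 1)" if "Y \<in> ?\<Y>" for Y
  proof -
    have "{v \<in> U - X. v \<in> Y} = Y - X"
      using that by (auto simp: subspaces_of_dim_def)
    then show ?thesis
      using that assms card_Diff_subspace[of X Y] by (auto simp: subspaces_of_dim_def algebra_simps)
  qed
  ultimately have "real (card ?\<Y>) * (Q ^ dim X * (Q - 1)) = Q ^ dim U - Q ^ dim X"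
    using card_Diff_subspace[OF assms] by simp
  moreover have "Q ^ dim U = Q ^ dim X * Q ^ (dim U - dim X)"
    using dim_subset[OF assms(3)] by (simp flip: power_add)
  ultimately have "Q ^ dim X * (real (card ?\<Y>) * (Q - 1))
      = Q ^ dim X * (\<theta> (dim U - dim X) * (Q - 1))"
    unfolding theta_mult by (simp add: algebra_simps)
  then show ?thesis
    using Q_ge_2 by simp
qed

lemma card_complements_eq_sum:
  assumes "subspace U" "subspace W" "W \<subseteq> U" "v \<in> U"
  shows "card {F \<in> complements_in U W. P F}
    = (\<Sum>w\<in>W. card {F \<in> complements_in U W. P F \<and> v + w \<in> F})"
proof -
  have "(\<Sum>w\<in>W. card {F \<in> {F \<in> complements_in U W. P F}. v + w \<in> F})
      = 1 * card {F \<in> complements_in U W. P F}"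
    using card_complement_Int_coset[OF assms(1-3) _ assms(4)] by (intro sum_multicount) auto
  then show ?thesis by (simp add: conj_assoc)
qed

lemma complements_containing_full:
  assumes "P \<in> complements_in U W"
  shows "{F \<in> complements_in U W. P \<subseteq> F} = {P}"
proof -
  have "F = P" if "F \<in> complements_in U W" "P \<subseteq> F" for F
    using that assms subspace_dim_equal[of P F] by (auto simp: complements_in_def)
  then show ?thesis using assms by blast
qed

lemma mem_complements_in_if_full:
  assumes "subspace W" "W \<subseteq> U" "subspace P" "P \<subseteq> U" "P \<inter> W = {0}"
    and "dim U - dim W - dim P = 0"
  shows "P \<in> complements_in U W"
  using dim_add_le_dim_Int[of P W U] assms by (simp add: complements_in_def)

lemma card_complements_containing:
  assumes "subspace U" "subspace W" "W \<subseteq> U" "subspace P" "P \<subseteq> U" "P \<inter> W = {0}"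
  shows "card {F \<in> complements_in U W. P \<subseteq> F} = q ^ (dim W * (dim U - dim W - dim P))"
  using assms(4-6)
proof (induction "dim U - dim W - dim P" arbitrary: P)
  case 0
  then have "P \<in> complements_in U W"
    using assms(2,3) by (intro mem_complements_in_if_full) simp_all
  then show ?case
    using 0 complements_containing_full by simp
next
  case (Suc d)
  have "dim (P \<union> W) < dim U"
    using dim_Un_Int[of P W] Suc assms by simp
  then obtain v where v: "v \<in> U" "v \<notin> span (P \<union> W)"
    using dim_subset[of U "span (P \<union> W)"] by force
  have "card {F \<in> complements_in U W. P \<subseteq> F \<and> v + w \<in> F} = q ^ (dim W * d)" if "w \<in> W" for w
  proof -
    let ?P = "span (insert (v + w) P)"
    note P = span_insert_coset[OF Suc.prems(1) assms(2) Suc.prems(3) v(2) that]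
    have codim: "dim U - dim W - dim ?P = d"
      using Suc.hyps(2) P(1) by linarith
    have "?P \<subseteq> U"
      using v that assms Suc.prems by (auto simp: span_insert_subset_iff intro: subspace_add)
    then have "card {F \<in> complements_in U W. ?P \<subseteq> F} = q ^ (dim W * d)"
      using Suc.hyps(1)[of ?P] codim P(2) by simp
    moreover have "{F \<in> complements_in U W. P \<subseteq> F \<and> v + w \<in> F} = {F \<in> complements_in U W. ?P \<subseteq> F}"
      by (intro Collect_cong) (metis span_insert_subset_complement_iff)
    ultimately show ?thesis by simp
  qed
  then have "card {F \<in> complements_in U W. P \<subseteq> F} = q ^ dim W * q ^ (dim W * d)"
    using card_complements_eq_sum[OF assms(1-3) v(1), of "\<lambda>F. P \<subseteq> F"] assms(2)
    by (simp add: card_subspace)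
  then show ?case
    using Suc.hyps(2) by (metis mult_Suc_right power_add)
qed

lemma card_Diff_span_Un:
  assumes "subspace W" "subspace M" "subspace P" "P \<subseteq> span (M \<union> W)"
  shows "real (card (W - span (P \<union> M)))
    = Q ^ dim W - Q ^ (dim P - dim (P \<inter> M) + dim (M \<inter> W))"
proof -
  have "subspace (W \<inter> span (P \<union> M))"
    using assms(1) by (intro subspace_inter) auto
  then have "real (card (W - W \<inter> span (P \<union> M))) = Q ^ dim W - Q ^ dim (W \<inter> span (P \<union> M))"
    using assms(1) by (intro card_Diff_subspace) auto
  moreover have "W - W \<inter> span (P \<union> M) = W - span (P \<union> M)"
    by blast
  ultimately show ?thesis
    using dim_Int_span_Un[OF assms] by simp
qed

lemma card_complements_Int_eq_sum:
  assumes "subspace U" "subspace W" "W \<subseteq> U" "subspace M" "M \<subseteq> U" "subspace P"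
    and v: "v \<in> M" "v \<notin> span (P \<union> W)"
  defines "P' \<equiv> \<lambda>w. span (insert (v + w) P)"
  shows "card {F \<in> complements_in U W. P \<subseteq> F \<and> F \<inter> M = P \<inter> M}
    = (\<Sum>w\<in>W - span (P \<union> M). card {F \<in> complements_in U W. P' w \<subseteq> F \<and> F \<inter> M = P' w \<inter> M})"
proof -
  let ?C = "\<lambda>w. {F \<in> complements_in U W. (P \<subseteq> F \<and> F \<inter> M = P \<inter> M) \<and> v + w \<in> F}"
  have in_span: "card (?C w) = 0" if "w \<in> W" "w \<in> span (P \<union> M)" for w
  proof -
    have "v + w \<notin> F" if "F \<in> complements_in U W" "P \<subseteq> F" "F \<inter> M = P \<inter> M" for F
      using that v \<open>w \<in> W\<close> \<open>w \<in> span (P \<union> M)\<close> assms(4,6)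
      by (intro add_notin_if_Int_eq[of P M]) (auto simp: complements_in_def)
    then have "?C w = {}" by auto
    then show ?thesis by (simp only: card.empty)
  qed
  have not_in_span: "?C w = {F \<in> complements_in U W. P' w \<subseteq> F \<and> F \<inter> M = P' w \<inter> M}"
    if "w \<notin> span (P \<union> M)" for w
    unfolding P'_def span_insert_coset_Int[OF assms(6,4) v(1) that]
    by (intro Collect_cong) (metis span_insert_subset_complement_iff)
  have "card {F \<in> complements_in U W. P \<subseteq> F \<and> F \<inter> M = P \<inter> M} = (\<Sum>w\<in>W. card (?C w))"
    using v(1) assms(5) by (intro card_complements_eq_sum[OF assms(1-3)]) auto
  also have "\<dots> = (\<Sum>w\<in>W - span (P \<union> M). card (?C w))"
    using in_span by (intro sum.mono_neutral_right) auto
  also have "\<dots> = (\<Sum>w\<in>W - span (P \<union> M). card {F \<in> complements_in U W. P' w \<subseteq> F \<and> F \<inter> M = P' w \<inter> M})"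
    using not_in_span by (intro sum.cong) auto
  finally show ?thesis .
qed

lemma card_complements_Int_eq:
  assumes "subspace U" "subspace W" "W \<subseteq> U" "subspace M" "span (M \<union> W) = U"
    and "subspace P" "P \<subseteq> U" "P \<inter> W = {0}"
  shows "real (card {F \<in> complements_in U W. P \<subseteq> F \<and> F \<inter> M = P \<inter> M})
    = (\<Prod>k\<in>{dim P..<dim U - dim W}. Q ^ dim W - Q ^ (k - dim (P \<inter> M) + dim (M \<inter> W)))"
  using assms(6-8)
proof (induction "dim U - dim W - dim P" arbitrary: P)
  case 0
  then have "P \<in> complements_in U W"
    using assms(2,3) by (intro mem_complements_in_if_full) simp_all
  then have "{F \<in> complements_in U W. P \<subseteq> F \<and> F \<inter> M = P \<inter> M} = {P}"
    using complements_containing_full by blast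
  then show ?case
    using 0 by simp
next
  case (Suc d)
  let ?P = "\<lambda>v w. span (insert (v + w) P)"
  let ?r = "\<lambda>k. Q ^ dim W - Q ^ (k - dim (P \<inter> M) + dim (M \<inter> W))"
  have M: "M \<subseteq> U"
    using assms(5) span_superset[of "M \<union> W"] by auto
  have "dim (P \<union> W) < dim (M \<union> W)"
    using dim_Un_Int[of P W] Suc assms dim_span[of "M \<union> W"] by simp
  then have "\<not> M \<union> W \<subseteq> span (P \<union> W)"
    using dim_subset[of "M \<union> W" "span (P \<union> W)"] by auto
  then obtain v where v: "v \<in> M" "v \<notin> span (P \<union> W)"
    by (auto intro: span_base)
  have card_extending: "real (card {F \<in> complements_in U W. ?P v w \<subseteq> F \<and> F \<inter> M = ?P v w \<inter> M})
      = (\<Prod>k\<in>{Suc (dim P)..<dim U - dim W}. ?r k)" if w: "w \<in> W - span (P \<union> M)" for w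
  proof -
    have "w \<in> W"
      using w by simp
    note P' = span_insert_coset[OF Suc.prems(1) assms(2) Suc.prems(3) v(2) this]
      span_insert_coset_Int[OF Suc.prems(1) assms(4) v(1), of w]
    have "?P v w \<subseteq> U"
      using v w assms M Suc.prems by (auto simp: span_insert_subset_iff intro!: subspace_add)
    then show ?thesis
      using Suc.hyps(2) P' w by (subst Suc.hyps(1)) auto
  qed
  have "real (card {F \<in> complements_in U W. P \<subseteq> F \<and> F \<inter> M = P \<inter> M})
      = real (card (W - span (P \<union> M))) * (\<Prod>k\<in>{Suc (dim P)..<dim U - dim W}. ?r k)"
    unfolding card_complements_Int_eq_sum[OF assms(1-4) M Suc.prems(1) v]
    using card_extending by simp
  also have "real (card (W - span (P \<union> M))) = ?r (dim P)"
    using assms(2,4,5) Suc.prems by (intro card_Diff_span_Un) auto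
  also have "?r (dim P) * (\<Prod>k\<in>{Suc (dim P)..<dim U - dim W}. ?r k)
      = (\<Prod>k\<in>{dim P..<dim U - dim W}. ?r k)"
    using Suc.hyps(2) by (subst (2) prod.atLeast_Suc_lessThan) auto
  finally show ?case .
qed

lemma card_hyperplanes_avoiding:
  assumes "subspace Z" "dim Z = Suc d" "v \<in> Z" "v \<noteq> 0"
  shows "card {H \<in> subspaces_of_dim Z d. v \<notin> H} = q ^ d"
proof -
  have v: "span {v} \<subseteq> Z" "dim (span {v}) = 1"
    using assms span_minimal[of "{v}" Z] by auto
  have "v \<notin> H \<longleftrightarrow> H \<inter> span {v} = {0}" if H: "subspace H" for H
  proof
    show "v \<notin> H" if "H \<inter> span {v} = {0}"
      using that assms(4) span_base[of v "{v}"] by auto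
    show "H \<inter> span {v} = {0}" if "v \<notin> H"
      using span_insert_Int[of "{0}" H v] that H subspace_0[OF H] insert_commute[of v 0 "{}"]
      by (simp add: Int_commute)
  qed
  then have "{H \<in> subspaces_of_dim Z d. v \<notin> H} = {H \<in> complements_in Z (span {v}). {0} \<subseteq> H}"
    using v assms(2) subspace_0 by (auto simp: subspaces_of_dim_def complements_in_def)
  then show ?thesis
    using card_complements_containing[of Z "span {v}" "{0}"] v assms by (simp add: subspace_0)
qed

lemma card_hyperplanes:
  assumes "subspace Z" "dim Z = Suc d"
  shows "real (card (subspaces_of_dim Z d)) = \<theta> (Suc d)"
proof -
  have "(\<Sum>H\<in>subspaces_of_dim Z d. card {v \<in> Z - {0}. v \<notin> H}) = q ^ d * card (Z - {0})"
    using card_hyperplanes_avoiding[OF assms] by (intro sum_multicount) auto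
  then have "(\<Sum>H\<in>subspaces_of_dim Z d. real (card {v \<in> Z - {0}. v \<notin> H}))
      = Q ^ d * real (card (Z - {0}))"
    by (simp flip: of_nat_mult of_nat_power of_nat_sum)
  moreover have "real (card {v \<in> Z - {0}. v \<notin> H}) = Q ^ d * (Q - 1)"
    if "H \<in> subspaces_of_dim Z d" for H
  proof -
    have "{v \<in> Z - {0}. v \<notin> H} = Z - H"
      using that subspace_0 by (auto simp: subspaces_of_dim_def)
    then show ?thesis
      using that assms card_Diff_subspace[of H Z] by (auto simp: subspaces_of_dim_def algebra_simps)
  qed
  moreover have "real (card (Z - {0})) = \<theta> (Suc d) * (Q - 1)"
    unfolding theta_mult using card_Diff_subspace[of "{0}" Z] assms by (simp add: subspace_0)
  ultimately have "Q ^ d * (Q - 1) * real (card (subspaces_of_dim Z d))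
      = Q ^ d * (Q - 1) * \<theta> (Suc d)"
    by (simp add: mult_ac)
  then show ?thesis
    using Q_ge_2 by simp
qed

lemma card_hyperplanes_within:
  assumes "subspace Z" "dim Z = Suc d" "subspace F" "d \<le> dim (F \<inter> Z)"
  shows "real (card {Y \<in> subspaces_of_dim Z d. Y \<subseteq> F}) = (if Z \<subseteq> F then \<theta> (Suc d) else 1)"
proof (cases "Z \<subseteq> F")
  case True
  then have "{Y \<in> subspaces_of_dim Z d. Y \<subseteq> F} = subspaces_of_dim Z d"
    by (auto simp: subspaces_of_dim_def)
  then show ?thesis
    using True card_hyperplanes[OF assms(1,2)] by simp
next
  case False
  have FZ: "subspace (F \<inter> Z)"
    using assms by (intro subspace_inter)
  then have dim: "dim (F \<inter> Z) = d"
    using False assms subspace_dim_equal[of "F \<inter> Z" Z] by fastforce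
  then have "Y = F \<inter> Z" if "Y \<in> subspaces_of_dim Z d" "Y \<subseteq> F" for Y
    using that FZ subspace_dim_equal[of Y "F \<inter> Z"] by (auto simp: subspaces_of_dim_def)
  moreover have "F \<inter> Z \<in> subspaces_of_dim Z d"
    using FZ dim by (auto simp: subspaces_of_dim_def)
  ultimately have "{Y \<in> subspaces_of_dim Z d. Y \<subseteq> F} = {F \<inter> Z}"
    by blast
  then show ?thesis
    using False by simp
qed

lemma card_subspaces_of_dim_Suc:
  assumes "subspace T" "dim T = t + Suc k"
  shows "real (card (subspaces_of_dim T t)) * \<theta> (Suc k)
    = real (card (subspaces_of_dim T (t + 1))) * \<theta> (t + 1)"
proof -
  have below: "{A \<in> subspaces_of_dim T t. A \<subseteq> B} = subspaces_of_dim B t"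
    if "B \<in> subspaces_of_dim T (t + 1)" for B
    using that by (auto simp: subspaces_of_dim_def)
  have above: "real (card {B \<in> subspaces_of_dim T (t + 1). A \<subseteq> B}) = \<theta> (Suc k)"
    if "A \<in> subspaces_of_dim T t" for A
    using that card_extensions[of A T] assms by (auto simp: subspaces_of_dim_def)
  have "(\<Sum>A\<in>subspaces_of_dim T t. card {B \<in> subspaces_of_dim T (t + 1). A \<subseteq> B})
      = (\<Sum>B\<in>subspaces_of_dim T (t + 1). card {A \<in> subspaces_of_dim T t. A \<subseteq> B})"
    by (intro sum_multicount_gen) auto
  then have "(\<Sum>A\<in>subspaces_of_dim T t. real (card {B \<in> subspaces_of_dim T (t + 1). A \<subseteq> B}))
      = (\<Sum>B\<in>subspaces_of_dim T (t + 1). real (card {A \<in> subspaces_of_dim T t. A \<subseteq> B}))"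
    by (simp flip: of_nat_sum)
  moreover have "real (card (subspaces_of_dim B t)) = \<theta> (t + 1)"
    if "B \<in> subspaces_of_dim T (t + 1)" for B
    using that card_hyperplanes[of B t] by (simp add: subspaces_of_dim_def)
  ultimately show ?thesis
    using below above by simp
qed

lemma card_subspaces_of_codim:
  assumes "subspace T" "dim T = t + k"
  shows "real (card (subspaces_of_dim T t)) = gaussian_binomial (t + k) k"
  using assms(2)
proof (induction k arbitrary: t)
  case 0
  have "S = T" if "subspace S" "S \<subseteq> T" "dim S = t" for S
    using subspace_dim_equal[of S T] that assms(1) 0 by simp
  then have "subspaces_of_dim T t = {T}"
    using assms(1) 0 by (auto simp: subspaces_of_dim_def)
  then show ?case by (simp add: gaussian_binomial_def)
next
  case (Suc k)
  have "real (card (subspaces_of_dim T t)) * \<theta> (Suc k)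
      = gaussian_binomial (t + Suc k) k * \<theta> (t + 1)"
    using card_subspaces_of_dim_Suc[OF assms(1) Suc.prems] Suc.IH[of "t + 1"] Suc.prems by simp
  then have "real (card (subspaces_of_dim T t)) * \<theta> (Suc k)
      = gaussian_binomial (t + Suc k) (Suc k) * \<theta> (Suc k)"
    by (simp only: gaussian_binomial_absorb)
  then show ?case
    using theta_ge_1[of "Suc k"] by simp
qed

end

section \<open>Comparison of the bounds\<close>

lemma prod_one_minus_le:
  fixes y :: "'i \<Rightarrow> real"
  assumes "finite I" "\<And>i. i \<in> I \<Longrightarrow> 0 \<le> y i \<and> y i \<le> 1"
  shows "(\<Prod>i\<in>I. 1 - y i) \<le> 1 / (1 + sum y I)"
proof -
  have sum: "0 \<le> sum y I"
    using assms(2) by (intro sum_nonneg) auto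
  have "(\<Prod>i\<in>I. 1 - y i) \<le> (\<Prod>i\<in>I. exp (- y i))"
    using assms(2) exp_ge_add_one_self[of "- y _"] by (intro prod_mono) auto
  also have "\<dots> = 1 / exp (sum y I)"
    using exp_sum[OF assms(1), of "\<lambda>i. - y i"] by (simp add: sum_negf exp_minus inverse_eq_divide)
  also have "\<dots> \<le> 1 / (1 + sum y I)"
    using sum by (intro divide_left_mono exp_ge_add_one_self mult_pos_pos) auto
  finally show ?thesis .
qed

locale extremal_parameters = gaussian_numbers q for q :: nat +
  fixes n l t :: nat
  assumes t_ge_1: "1 \<le> t" and t_add_2_le_n: "t + 2 \<le> n" and l_ge: "n + t + 2 \<le> l"
    and l_ge_if_q_eq_2: "q = 2 \<Longrightarrow> n + t + 4 \<le> l"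
begin

text \<open>\<open>N k\<close> counts the \<open>(n, 0)\<close>-subspaces through a fixed \<open>(t + k, 0)\<close>-subspace.\<close>

definition N :: "nat \<Rightarrow> real" where
  "N k = Q ^ (l * (n - t - k))"

definition H1_size :: real where
  "H1_size = Q ^ (l * (n - t)) - (\<Prod>j = 1..n - t. Q ^ l - Q ^ j) + Q ^ (n - t) * (Q ^ t - 1)"

definition H2_size :: real where
  "H2_size = Q ^ (l * (n - t - 1)) * \<theta> (t + 2) - Q ^ (l * (n - t - 2) + 1) * \<theta> (t + 1)"

text \<open>In its own range of \<open>t\<close>, each extremal size is at least about \<open>q \<theta>\<^bsub>n-t\<^esub> q\<^bsup>l(n-t-1)\<^esup>\<close>. The
  factor \<open>15/16\<close> absorbs the error and keeps the threshold above the bounds of the other cases.\<close>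

definition threshold :: real where
  "threshold = 15 / 16 * (Q * \<theta> (n - t) * N 1)"

definition cover_bound :: "nat \<Rightarrow> real" where
  "cover_bound k = gaussian_binomial (t + k) k * \<theta> (n - t + 1) ^ k * N k"

lemma N_pos: "0 < N k"
  using Q_ge_2 by (simp add: N_def)

lemma N_eq_mult_Suc:
  assumes "k < n - t"
  shows "N k = Q ^ l * N (Suc k)"
proof -
  have "n - t - k = Suc (n - t - Suc k)"
    using assms by simp
  then show ?thesis
    by (simp add: N_def power_add)
qed

lemma N_1_eq: "N 1 = Q ^ l * N 2"
  using N_eq_mult_Suc[of 1] t_add_2_le_n by (simp add: numeral_2_eq_2)

lemma Q_power_pos: "0 < Q ^ m"
  using Q_ge_2 by simp

lemma theta_n_minus_t_pos: "0 < \<theta> (n - t)"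
  using theta_ge_1[of "n - t"] t_add_2_le_n by linarith

text \<open>The excluded pairs \<open>(l, q)\<close> are the ones violating this inequality.\<close>

lemma Q_power_less_Q_power_l: "Q ^ (n + t + 4) < 15 / 16 * Q * (Q - 1) ^ 3 * Q ^ l"
proof (cases "q = 2")
  case True
  have "Q ^ (n + t + 4) \<le> Q ^ l"
    using True l_ge_if_q_eq_2 by (intro power_increasing) auto
  also have "\<dots> < 15 / 16 * Q * (Q - 1) ^ 3 * Q ^ l"
    using True by simp
  finally show ?thesis .
next
  case False
  then have Q: "3 \<le> Q"
    using q_ge_2 by simp
  have "4 * (Q - 1) \<le> (Q - 1)\<^sup>2 * (Q - 1)"
    using power_mono[of 2 "Q - 1" 2] Q by (intro mult_right_mono) auto
  then have "Q < 15 / 16 * (Q - 1) ^ 3"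
    using Q by (simp add: power2_eq_square power3_eq_cube)
  have "Q ^ (n + t + 4) = Q * Q * Q ^ (n + t + 2)"
    by (simp add: power_add eval_nat_numeral)
  also have "\<dots> \<le> Q * Q * Q ^ l"
    using Q l_ge by (intro mult_left_mono power_increasing) auto
  also have "\<dots> < Q * (15 / 16 * (Q - 1) ^ 3) * Q ^ l"
    using Q \<open>Q < 15 / 16 * (Q - 1) ^ 3\<close> by (intro mult_strict_right_mono mult_strict_left_mono) auto
  finally show ?thesis
    by (simp only: mult_ac)
qed

lemma theta_product_less:
  "\<theta> (t + 1) * \<theta> (t + 2) * (\<theta> (n - t + 1))\<^sup>2 < 15 / 16 * Q * (Q + 1) * \<theta> (n - t) * Q ^ l"
proof -
  let ?lhs = "\<theta> (t + 1) * \<theta> (t + 2) * (\<theta> (n - t + 1))\<^sup>2"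
  have exponents: "t + 1 + (t + 2) + (n - t + 1) = n + t + 4"
    using t_add_2_le_n by simp
  have "?lhs * (Q - 1) ^ 3
      = (\<theta> (t + 1) * (Q - 1)) * (\<theta> (t + 2) * (Q - 1)) * (\<theta> (n - t + 1) * (Q - 1)) * \<theta> (n - t + 1)"
    by (simp add: power2_eq_square power3_eq_cube mult_ac)
  also have "\<dots> \<le> Q ^ (t + 1) * Q ^ (t + 2) * Q ^ (n - t + 1) * ((Q + 1) * \<theta> (n - t))"
    using theta_Suc_le[of "n - t"] t_add_2_le_n Q_ge_2
    by (intro mult_mono theta_mult_le mult_nonneg_nonneg theta_nonneg) auto
  also have "\<dots> = Q ^ (n + t + 4) * ((Q + 1) * \<theta> (n - t))"
    by (simp only: exponents flip: power_add)
  also have "\<dots> < 15 / 16 * Q * (Q - 1) ^ 3 * Q ^ l * ((Q + 1) * \<theta> (n - t))"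
    using Q_power_less_Q_power_l Q_ge_2 theta_n_minus_t_pos by (intro mult_strict_right_mono) auto
  also have "\<dots> = 15 / 16 * Q * (Q + 1) * \<theta> (n - t) * Q ^ l * (Q - 1) ^ 3"
    by (simp only: mult_ac)
  finally show ?thesis
    using Q_ge_2 by (subst (asm) mult_less_cancel_right_pos) auto
qed

lemma Q_theta_le_Q_power_l: "16 * (Q * \<theta> (n - t)) \<le> Q ^ l"
proof -
  have "0 \<le> (Q - 2)\<^sup>2"
    by simp
  then have "4 * (Q - 1) \<le> Q\<^sup>2"
    by (simp add: power2_eq_square algebra_simps)
  then have "(4 * (Q - 1))\<^sup>2 \<le> (Q\<^sup>2)\<^sup>2"
    using Q_ge_2 by (intro power_mono) auto
  moreover have "15 * (Q - 1)\<^sup>2 \<le> (4 * (Q - 1))\<^sup>2"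
    unfolding power_mult_distrib by (intro mult_right_mono) auto
  ultimately have Q_fourth: "15 * (Q - 1)\<^sup>2 \<le> Q ^ 4"
    by simp
  have "15 * Q\<^sup>2 * (Q - 1) ^ 3 * \<theta> (n - t) = 15 * (Q - 1)\<^sup>2 * (Q\<^sup>2 * (\<theta> (n - t) * (Q - 1)))"
    by (simp add: power2_eq_square power3_eq_cube)
  also have "\<dots> \<le> Q ^ 4 * (Q\<^sup>2 * Q ^ (n - t))"
    using Q_fourth Q_ge_2 by (intro mult_mono mult_nonneg_nonneg theta_mult_le theta_nonneg) auto
  also have "\<dots> = Q ^ (n - t + 6)"
    by (simp add: power_add eval_nat_numeral)
  also have "\<dots> \<le> Q ^ (n + t + 4)"
    using Q_ge_2 t_ge_1 t_add_2_le_n by (intro power_increasing) auto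
  also have "\<dots> < 15 / 16 * Q * (Q - 1) ^ 3 * Q ^ l"
    by (rule Q_power_less_Q_power_l)
  finally have "15 / 16 * Q * (Q - 1) ^ 3 * (16 * (Q * \<theta> (n - t)))
      < 15 / 16 * Q * (Q - 1) ^ 3 * Q ^ l"
    by (simp add: power2_eq_square mult_ac)
  then show ?thesis
    using Q_ge_2 by (subst (asm) mult_less_cancel_left_pos) auto
qed

lemma cover_bound_2_less_threshold: "cover_bound 2 < threshold"
proof -
  have "gaussian_binomial (t + 2) 2 = \<theta> (t + 1) * \<theta> (t + 2) / (Q + 1)"
    using theta_Suc'[of 1] by (simp add: gaussian_binomial_def numeral_2_eq_2 add.commute)
  then have "cover_bound 2 = \<theta> (t + 1) * \<theta> (t + 2) * (\<theta> (n - t + 1))\<^sup>2 / (Q + 1) * N 2"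
    by (simp add: cover_bound_def)
  also have "\<dots> < 15 / 16 * Q * \<theta> (n - t) * Q ^ l * N 2"
    using theta_product_less Q_ge_2 N_pos[of 2]
    by (intro mult_strict_right_mono) (simp_all add: divide_less_eq algebra_simps)
  also have "\<dots> = threshold"
    unfolding threshold_def N_1_eq by simp
  finally show ?thesis .
qed

lemma cover_bound_Suc_le:
  assumes "k < n - t"
  shows "cover_bound (Suc k) \<le> cover_bound k"
proof -
  have "\<theta> (t + Suc k) / \<theta> (Suc k) \<le> \<theta> (t + 1)"
    using theta_add_le[of "Suc k" t] theta_ge_1[of "Suc k"] by (simp add: divide_le_eq mult.commute)
  also have "\<dots> \<le> Q ^ (t + 1)"
    by (rule theta_le)
  finally have "\<theta> (t + Suc k) / \<theta> (Suc k) * \<theta> (n - t + 1) \<le> Q ^ (t + 1) * Q ^ (n - t + 1)"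
    by (intro mult_mono theta_le theta_nonneg) auto
  also have "\<dots> \<le> Q ^ l"
    unfolding power_add[symmetric] using Q_ge_2 t_add_2_le_n l_ge by (intro power_increasing) auto
  finally have ratio: "\<theta> (t + Suc k) / \<theta> (Suc k) * \<theta> (n - t + 1) \<le> Q ^ l" .
  have "cover_bound (Suc k) = gaussian_binomial (t + k) k * \<theta> (n - t + 1) ^ k
      * (\<theta> (t + Suc k) / \<theta> (Suc k) * \<theta> (n - t + 1)) * N (Suc k)"
    unfolding cover_bound_def gaussian_binomial_add_Suc by (simp add: mult_ac)
  also have "\<dots> \<le> gaussian_binomial (t + k) k * \<theta> (n - t + 1) ^ k * Q ^ l * N (Suc k)"
    using ratio gaussian_binomial_nonneg theta_nonneg N_pos[of "Suc k"]
    by (intro mult_right_mono mult_left_mono) auto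
  also have "\<dots> = cover_bound k"
    using N_eq_mult_Suc[OF assms] by (simp add: cover_bound_def)
  finally show ?thesis .
qed

lemma cover_bound_less_threshold:
  assumes "2 \<le> k" "k \<le> n - t"
  shows "cover_bound k < threshold"
  using assms
proof (induction k rule: dec_induct)
  case base
  show ?case by (rule cover_bound_2_less_threshold)
next
  case (step k)
  then show ?case
    using cover_bound_Suc_le[of k] by simp
qed

lemma few_covers_less_threshold:
  "\<theta> (n - t) * N 1 + \<theta> (t + 1) * (\<theta> (n - t + 1))\<^sup>2 * N 2 < threshold"
proof -
  let ?x = "\<theta> (t + 1) * (\<theta> (n - t + 1))\<^sup>2"
  have "0 \<le> 15 * Q\<^sup>2 * (Q - 2) + 14 * Q * (Q - 2) + 12 * (Q - 2) + 8"
    using Q_ge_2 by (intro add_nonneg_nonneg mult_nonneg_nonneg) auto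
  then have "15 * Q * (Q + 1) \<le> (1 + Q * (1 + Q)) * (15 * Q - 16)"
    by (simp add: power2_eq_square algebra_simps)
  also have "\<dots> \<le> \<theta> (t + 2) * (15 * Q - 16)"
    using theta_mono[of 3 "t + 2"] t_ge_1 Q_ge_2
    by (intro mult_right_mono) (auto simp: theta_Suc' eval_nat_numeral)
  finally have "?x * (15 * Q * (Q + 1)) \<le> ?x * (\<theta> (t + 2) * (15 * Q - 16))"
    using theta_nonneg by (intro mult_left_mono) auto
  also have "\<dots> = \<theta> (t + 1) * \<theta> (t + 2) * (\<theta> (n - t + 1))\<^sup>2 * (15 * Q - 16)"
    by (simp only: mult_ac)
  also have "\<dots> < 15 / 16 * Q * (Q + 1) * \<theta> (n - t) * Q ^ l * (15 * Q - 16)"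
    using theta_product_less Q_ge_2 by (intro mult_strict_right_mono) auto
  also have "\<dots> = (15 / 16 * Q - 1) * \<theta> (n - t) * Q ^ l * (15 * Q * (Q + 1))"
    by (simp add: field_simps)
  finally have "?x < (15 / 16 * Q - 1) * \<theta> (n - t) * Q ^ l"
    using Q_ge_2 by (subst (asm) mult_less_cancel_right_pos) auto
  then have "?x * N 2 < (15 / 16 * Q - 1) * \<theta> (n - t) * Q ^ l * N 2"
    using N_pos by (intro mult_strict_right_mono)
  then show ?thesis
    unfolding threshold_def N_1_eq by (simp add: algebra_simps)
qed

lemma H1_product_bounds:
  defines "s \<equiv> Q * \<theta> (n - t) / Q ^ l"
  shows "Q ^ (l * (n - t)) * (1 - s) \<le> (\<Prod>j = 1..n - t. Q ^ l - Q ^ j)"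
    and "(\<Prod>j = 1..n - t. Q ^ l - Q ^ j) \<le> Q ^ (l * (n - t)) * (1 / (1 + s))"
proof -
  have "(\<Prod>j = 1..n - t. Q ^ l - Q ^ j) = (\<Prod>j = 1..n - t. Q ^ l * (1 - Q ^ j / Q ^ l))"
    using Q_power_pos[of l] by (intro prod.cong) (auto simp: field_simps)
  also have "\<dots> = Q ^ (l * (n - t)) * (\<Prod>j = 1..n - t. 1 - Q ^ j / Q ^ l)"
    by (simp add: prod.distrib power_mult)
  finally have prod: "(\<Prod>j = 1..n - t. Q ^ l - Q ^ j)
      = Q ^ (l * (n - t)) * (\<Prod>j = 1..n - t. 1 - Q ^ j / Q ^ l)" .
  have sum: "(\<Sum>j = 1..n - t. Q ^ j / Q ^ l) = s"
    using sum_powers_eq[of "n - t"] by (simp add: s_def flip: sum_divide_distrib)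
  have factor: "0 \<le> Q ^ j / Q ^ l \<and> Q ^ j / Q ^ l \<le> 1" if "j \<in> {1..n - t}" for j
    using that Q_ge_2 t_add_2_le_n l_ge by (auto simp: divide_le_eq intro!: power_increasing)
  have "1 - s \<le> (\<Prod>j = 1..n - t. 1 - Q ^ j / Q ^ l)"
    unfolding sum[symmetric] using factor by (intro Weierstrass_prod_ineq) auto
  then show "Q ^ (l * (n - t)) * (1 - s) \<le> (\<Prod>j = 1..n - t. Q ^ l - Q ^ j)"
    unfolding prod by (rule mult_left_mono) simp
  have "(\<Prod>j = 1..n - t. 1 - Q ^ j / Q ^ l) \<le> 1 / (1 + s)"
    unfolding sum[symmetric] using factor by (intro prod_one_minus_le) auto
  then show "(\<Prod>j = 1..n - t. Q ^ l - Q ^ j) \<le> Q ^ (l * (n - t)) * (1 / (1 + s))"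
    unfolding prod by (rule mult_left_mono) simp
qed

lemma Q_power_mult_theta_div: "Q ^ (l * (n - t)) * (Q * \<theta> (n - t) / Q ^ l) = Q * \<theta> (n - t) * N 1"
  using N_eq_mult_Suc[of 0] t_add_2_le_n Q_power_pos[of l] by (simp add: N_def)

lemma threshold_le_H1_size: "threshold \<le> H1_size"
proof -
  define s where "s = Q * \<theta> (n - t) / Q ^ l"
  have s: "0 \<le> s" "s \<le> 1 / 16"
    using Q_theta_le_Q_power_l Q_power_pos[of l] theta_nonneg[of "n - t"]
    by (auto simp: s_def divide_le_eq)
  have "threshold = Q ^ (l * (n - t)) * (15 / 16 * s)"
    unfolding threshold_def Q_power_mult_theta_div[symmetric] s_def by simp
  also have "15 / 16 * (s * (1 + s)) \<le> s"
    using mult_left_mono[OF s(2) s(1)] s by (simp add: algebra_simps)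
  then have "15 / 16 * s \<le> 1 - 1 / (1 + s)"
    using s by (simp add: field_simps)
  then have "Q ^ (l * (n - t)) * (15 / 16 * s) \<le> Q ^ (l * (n - t)) * (1 - 1 / (1 + s))"
    by (rule mult_left_mono) simp
  also have "\<dots> \<le> Q ^ (l * (n - t)) - (\<Prod>j = 1..n - t. Q ^ l - Q ^ j)"
    using H1_product_bounds(2) by (simp add: s_def algebra_simps)
  also have "\<dots> \<le> H1_size"
    using Q_ge_2 by (simp add: H1_size_def)
  finally show ?thesis .
qed

lemma H1_size_le: "H1_size \<le> Q * \<theta> (n - t) * N 1 + Q ^ n"
proof -
  have "Q ^ (l * (n - t)) - (\<Prod>j = 1..n - t. Q ^ l - Q ^ j) \<le> Q * \<theta> (n - t) * N 1"
    using H1_product_bounds(1) unfolding Q_power_mult_theta_div[symmetric]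
    by (simp add: algebra_simps)
  moreover have "Q ^ (n - t) * (Q ^ t - 1) \<le> Q ^ (n - t) * Q ^ t"
    by (intro mult_left_mono) auto
  moreover have "Q ^ (n - t) * Q ^ t = Q ^ n"
    using t_add_2_le_n by (simp flip: power_add)
  ultimately show ?thesis
    unfolding H1_size_def by linarith
qed

lemma H2_size_eq: "H2_size = N 1 + Q * \<theta> (t + 1) * (N 1 - N 2)"
  using theta_Suc'[of "t + 1"] by (simp add: H2_size_def N_def algebra_simps)

lemma N_2_le: "16 * N 2 \<le> N 1"
proof -
  have "1 * 1 \<le> Q * \<theta> (n - t)"
    using Q_ge_2 theta_ge_1[of "n - t"] t_add_2_le_n by (intro mult_mono) auto
  then have "16 \<le> Q ^ l"
    using Q_theta_le_Q_power_l by linarith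
  then show ?thesis
    unfolding N_1_eq using N_pos[of 2] by (intro mult_right_mono) auto
qed

lemma threshold_le_H2_size:
  assumes "n - t \<le> t + 1"
  shows "threshold \<le> H2_size"
proof -
  have "threshold = Q * \<theta> (n - t) * (15 / 16 * N 1)"
    by (simp add: threshold_def)
  also have "\<dots> \<le> Q * \<theta> (t + 1) * (N 1 - N 2)"
    using theta_mono[OF assms] N_2_le N_pos[of 2] theta_nonneg Q_ge_2 by (intro mult_mono) auto
  also have "\<dots> \<le> H2_size"
    using N_pos[of 1] by (simp add: H2_size_eq)
  finally show ?thesis .
qed

lemma theta_mult_N_1_less_threshold: "\<theta> (n - t) * N 1 < threshold"
proof -
  have "1 * (\<theta> (n - t) * N 1) < 15 / 16 * Q * (\<theta> (n - t) * N 1)"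
    using Q_ge_2 theta_n_minus_t_pos N_pos[of 1] by (intro mult_strict_right_mono) auto
  then show ?thesis
    by (simp add: threshold_def mult.assoc)
qed

lemma H2_size_less_H1_size:
  assumes "t + 2 \<le> n - t"
  shows "H2_size < H1_size"
proof -
  have "H2_size \<le> \<theta> (t + 2) * N 1"
    using theta_nonneg by (simp add: H2_size_def N_def mult.commute)
  also have "\<dots> \<le> \<theta> (n - t) * N 1"
    using theta_mono[OF assms] N_pos[of 1] by (intro mult_right_mono) auto
  finally show ?thesis
    using theta_mult_N_1_less_threshold threshold_le_H1_size by linarith
qed

lemma Q_power_mult_N_1_less_H1_size:
  assumes "t + 2 \<le> n - t"
  shows "Q ^ (t + 1) * N 1 < H1_size"
proof -
  have "Q ^ (t + 1) \<le> \<theta> (n - t)"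
    using power_le_theta_Suc[of "t + 1"] theta_mono[OF assms] by simp
  then have "Q ^ (t + 1) * N 1 \<le> \<theta> (n - t) * N 1"
    using N_pos[of 1] by (intro mult_right_mono) auto
  then show ?thesis
    using theta_mult_N_1_less_threshold threshold_le_H1_size by linarith
qed

lemma H1_size_less_H2_size:
  assumes "n - t \<le> t + 1"
  shows "H1_size < H2_size"
proof -
  have "Q * \<theta> (t + 1) \<le> Q * Q ^ (t + 1)"
    by (intro mult_left_mono theta_le) simp
  also have "\<dots> = Q ^ (t + 2)"
    by simp
  also have "\<dots> \<le> Q ^ n"
    using Q_ge_2 t_add_2_le_n by (intro power_increasing) auto
  finally have "Q * \<theta> (t + 1) * N 2 \<le> Q ^ n * N 2"
    using N_pos[of 2] by (intro mult_right_mono) auto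
  moreover have "Q ^ n * 1 \<le> Q ^ n * N 2"
    using Q_ge_2 by (intro mult_left_mono) (auto simp: N_def)
  moreover have "Q ^ n * N 2 + Q ^ n * N 2 \<le> Q ^ (n + 1) * N 2"
    using Q_ge_2 N_pos[of 2] mult_right_mono[of 2 Q "Q ^ n * N 2"] by simp
  moreover have "Q ^ (n + 1) * N 2 < N 1"
    unfolding N_1_eq using Q_ge_2 l_ge N_pos[of 2]
    by (intro mult_strict_right_mono power_strict_increasing) auto
  ultimately have "Q ^ n + Q * \<theta> (t + 1) * N 2 < N 1"
    by linarith
  moreover have "Q * \<theta> (n - t) * N 1 \<le> Q * \<theta> (t + 1) * N 1"
    using theta_mono[OF assms] N_pos[of 1] Q_ge_2 by (intro mult_right_mono mult_left_mono) auto
  ultimately show ?thesis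
    using H1_size_le unfolding H2_size_eq by (simp add: right_diff_distrib)
qed

lemma Q_power_mult_N_1_less_H2_size: "Q ^ (t + 1) * N 1 < H2_size"
proof -
  have "Q ^ 1 < Q ^ l"
    using Q_ge_2 l_ge by (intro power_strict_increasing) auto
  then have "Q * N 2 < N 1"
    unfolding N_1_eq using N_pos[of 2] by (intro mult_strict_right_mono) auto
  then have "0 < \<theta> (t + 1) * (N 1 - Q * N 2)"
    using theta_ge_1[of "t + 1"] by (intro mult_pos_pos) auto
  also have "\<dots> = H2_size - Q ^ (t + 1) * N 1"
    using theta_Suc[of "t + 1"] by (simp add: H2_size_def N_def algebra_simps)
  finally show ?thesis by simp
qed

end

section \<open>The subspaces avoiding \<open>W\<close>\<close>

locale attenuated_space = finite_field_vector_space +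
  fixes W :: "'b set" and n l :: nat
  assumes subspace_W: "subspace W" and dim_W: "dim W = l" and dim_V: "dim UNIV = n + l"
begin

declare dim_UNIV [simp del]

abbreviation complements :: "'b set set" where
  "complements \<equiv> complements_in UNIV W"

definition avoids_W :: "'b set \<Rightarrow> bool" where
  "avoids_W P \<longleftrightarrow> subspace P \<and> P \<inter> W = {0}"

definition H2 :: "nat \<Rightarrow> 'b set \<Rightarrow> 'b set set" where
  "H2 t Z = {F \<in> subspaces_of_type scale W UNIV n 0. t + 1 \<le> dim (F \<inter> Z)}"

lemma avoids_W_subset: "avoids_W P \<Longrightarrow> subspace S \<Longrightarrow> S \<subseteq> P \<Longrightarrow> avoids_W S"
  using subspace_0[of S] subspace_0[OF subspace_W] by (auto simp: avoids_W_def)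

lemma mem_complements_iff: "F \<in> complements \<longleftrightarrow> avoids_W F \<and> dim F = n"
  by (auto simp: complements_in_def avoids_W_def dim_W dim_V)

lemma complementsD:
  assumes "F \<in> complements"
  shows "avoids_W F" "subspace F" "dim F = n"
  using assms by (auto simp: mem_complements_iff avoids_W_def)

lemma has_type_0_iff: "has_type scale W m 0 P \<longleftrightarrow> avoids_W P \<and> dim P = m"
proof -
  have "dim (P \<inter> W) = 0 \<longleftrightarrow> P \<inter> W = {0}" if "subspace P"
    using that subspace_W by (intro dim_eq_0_subspace subspace_inter)
  then show ?thesis
    unfolding has_type_def avoids_W_def by blast
qed

lemma subspaces_of_type_0_eq: "subspaces_of_type scale W S n 0 = {F \<in> complements. F \<subseteq> S}"
  by (auto simp: subspaces_of_type_def has_type_0_iff mem_complements_iff)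

lemma H1_eq: "H1 scale W n t X M
    = {F \<in> complements. X \<subseteq> F \<and> t + 1 \<le> dim (F \<inter> M)} \<union> {F \<in> complements. F \<subseteq> M}"
  by (simp add: H1_def subspaces_of_type_0_eq)

lemma H2_eq: "H2 t Z = {F \<in> complements. t + 1 \<le> dim (F \<inter> Z)}"
  by (simp add: H2_def subspaces_of_type_0_eq)

lemma dim_le_if_avoids_W:
  assumes "avoids_W P"
  shows "dim P \<le> n"
  using dim_add_le_dim_Int[of P W UNIV] assms subspace_W by (simp add: avoids_W_def dim_W dim_V)

lemma card_complements_through:
  assumes "avoids_W P"
  shows "card {F \<in> complements. P \<subseteq> F} = q ^ (l * (n - dim P))"
  using card_complements_containing[of UNIV W P] assms subspace_W
  by (simp add: avoids_W_def dim_W dim_V)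

lemma obtain_complement_in_general_position:
  assumes "avoids_W T" "subspace S" "dim S \<le> l"
  obtains F where "F \<in> complements" "T \<subseteq> F" "F \<inter> S = T \<inter> S"
proof -
  have "\<exists>F\<in>complements. T \<subseteq> F \<and> F \<inter> S = T \<inter> S"
    using assms(1)
  proof (induction "n - dim T" arbitrary: T)
    case 0
    then have "T \<in> complements"
      using dim_le_if_avoids_W[of T] by (simp add: mem_complements_iff)
    then show ?case by blast
  next
    case (Suc d)
    have T: "subspace T" "T \<inter> W = {0}"
      using Suc.prems by (auto simp: avoids_W_def)
    have "dim (T \<union> W) < dim UNIV" "dim (T \<union> S) < dim UNIV"
      using dim_Un_Int[of T W] dim_Un_Int[of T S] T Suc.hyps(2) assms(2,3) subspace_W
      by (auto simp: dim_W dim_V)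
    then have "span (T \<union> W) \<noteq> UNIV" "span (T \<union> S) \<noteq> UNIV"
      by (metis dim_span less_irrefl)+
    then obtain v where v: "v \<notin> span (T \<union> W)" "v \<notin> span (T \<union> S)"
      using obtain_not_in_two_subspaces[OF subspace_span subspace_span] by blast
    let ?T = "span (insert v T)"
    have Int: "?T \<inter> W = {0}" "?T \<inter> S = T \<inter> S"
      using span_insert_Int[OF T(1) subspace_W v(1)] span_insert_Int[OF T(1) assms(2) v(2)] T(2)
      by simp_all
    have "v \<notin> T"
      using v(1) by (meson UnI1 span_base)
    then have "d = n - dim ?T"
      using Suc.hyps(2) T(1) by (simp add: dim_insert)
    then have "\<exists>F\<in>complements. ?T \<subseteq> F \<and> F \<inter> S = ?T \<inter> S"
      by (rule Suc.hyps(1)) (use Int in \<open>simp add: avoids_W_def\<close>)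
    then obtain F where F: "F \<in> complements" "?T \<subseteq> F" "F \<inter> S = T \<inter> S"
      using Int(2) by auto
    have "T \<subseteq> F"
      using subset_span_insert F(2) by (rule order_trans)
    then show ?case
      using F(1,3) by blast
  qed
  then show ?thesis using that by blast
qed

lemma card_complements_between:
  assumes "subspace M" "dim M = n + dim (M \<inter> W)" "avoids_W P" "P \<subseteq> M"
  shows "card {F \<in> complements. P \<subseteq> F \<and> F \<subseteq> M} = q ^ (dim (M \<inter> W) * (n - dim P))"
proof -
  have "F \<inter> (M \<inter> W) = F \<inter> W" if "F \<subseteq> M" for F
    using that by blast
  then have "{F \<in> complements. P \<subseteq> F \<and> F \<subseteq> M} = {F \<in> complements_in M (M \<inter> W). P \<subseteq> F}"
    using assms(2) by (auto simp: complements_in_def dim_W dim_V)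
  moreover have "P \<inter> (M \<inter> W) = {0}"
    using assms(3,4) by (auto simp: avoids_W_def)
  ultimately show ?thesis
    using card_complements_containing[of M "M \<inter> W" P] assms subspace_W
    by (simp add: avoids_W_def subspace_inter)
qed

lemma card_complements_Int_eq_subspace:
  assumes "subspace M" "dim M = n + dim (M \<inter> W)" "avoids_W X" "X \<subseteq> M"
  shows "real (card {F \<in> complements. X \<subseteq> F \<and> F \<inter> M = X})
    = (\<Prod>k\<in>{dim X..<n}. Q ^ l - Q ^ (k - dim X + dim (M \<inter> W)))"
proof -
  have "dim (M \<union> W) = dim UNIV"
    using dim_Un_Int[of M W] assms(1,2) subspace_W by (simp add: dim_W dim_V)
  then have "span (M \<union> W) = UNIV"
    using subspace_dim_equal[of "span (M \<union> W)" UNIV] by simp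
  moreover have "X \<inter> M = X"
    using assms(4) by blast
  ultimately show ?thesis
    using card_complements_Int_eq[of UNIV W M X] assms subspace_W
    by (simp add: avoids_W_def dim_W dim_V)
qed

lemma H1_eq_Un_Diff:
  assumes "avoids_W X" "dim X = t" "subspace M" "X \<subseteq> M" "t < n"
  shows "H1 scale W n t X M
    = ({F \<in> complements. X \<subseteq> F} - {F \<in> complements. X \<subseteq> F \<and> F \<inter> M = X})
      \<union> ({F \<in> complements. F \<subseteq> M} - {F \<in> complements. X \<subseteq> F \<and> F \<subseteq> M})"
proof -
  have iff: "t + 1 \<le> dim (F \<inter> M) \<longleftrightarrow> F \<inter> M \<noteq> X" if "F \<in> complements" "X \<subseteq> F" for F
  proof
    show "t + 1 \<le> dim (F \<inter> M) \<Longrightarrow> F \<inter> M \<noteq> X"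
      using assms(2) by auto
    assume "F \<inter> M \<noteq> X"
    moreover have "subspace X" "subspace (F \<inter> M)" "X \<subseteq> F \<inter> M"
      using that assms complementsD by (auto simp: avoids_W_def intro: subspace_inter)
    ultimately show "t + 1 \<le> dim (F \<inter> M)"
      using subspace_dim_equal[of X "F \<inter> M"] assms(2) by (metis Suc_eq_plus1 not_less_eq_eq)
  qed
  have "F \<inter> M \<noteq> X" if "F \<in> complements" "F \<subseteq> M" for F
    using that assms(2,5) complementsD(3)[of F] by (auto simp: Int_absorb2)
  then show ?thesis
    unfolding H1_eq using iff by blast
qed

lemma card_H1:
  assumes X: "has_type scale W t 0 X" and M: "has_type scale W (n + 1) 1 M" and "X \<subseteq> M" "t < n"
  shows "real (card (H1 scale W n t X M))
    = Q ^ (l * (n - t)) - (\<Prod>j = 1..n - t. Q ^ l - Q ^ j) + Q ^ (n - t) * (Q ^ t - 1)"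
proof -
  let ?through = "{F \<in> complements. X \<subseteq> F}" and ?meeting = "{F \<in> complements. X \<subseteq> F \<and> F \<inter> M = X}"
  let ?within = "{F \<in> complements. F \<subseteq> M}" and ?between = "{F \<in> complements. X \<subseteq> F \<and> F \<subseteq> M}"
  have X': "avoids_W X" "dim X = t" and M': "subspace M" "dim M = n + dim (M \<inter> W)" "dim (M \<inter> W) = 1"
    using X M by (simp_all add: has_type_0_iff) (simp_all add: has_type_def)
  have card_Diff: "real (card (A - B)) = real (card A) - real (card B)"
    if "B \<subseteq> A" for A B :: "'b set set"
    using that by (simp add: card_Diff_subset of_nat_diff card_mono)
  have "?within = {F \<in> complements. {0} \<subseteq> F \<and> F \<subseteq> M}"
    using subspace_0 complementsD(2) by auto
  then have within: "card ?within = q ^ n"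
    using card_complements_between[OF M'(1,2), of "{0}"] M' subspace_0 subspace_W
    by (simp add: avoids_W_def)
  have between: "card ?between = q ^ (n - t)"
    using card_complements_between[OF M'(1,2) X'(1) \<open>X \<subseteq> M\<close>] X' M' by simp
  have through: "card ?through = q ^ (l * (n - t))"
    using card_complements_through[OF X'(1)] X'(2) by simp
  have "real (card ?meeting) = (\<Prod>k\<in>{t..<n}. Q ^ l - Q ^ (k - t + 1))"
    using card_complements_Int_eq_subspace[OF M'(1,2) X'(1) \<open>X \<subseteq> M\<close>] X' M' by simp
  also have "\<dots> = (\<Prod>j = 1..n - t. Q ^ l - Q ^ j)"
    by (rule prod.reindex_bij_witness[of _ "\<lambda>j. j + t - 1" "\<lambda>k. k - t + 1"]) (use \<open>t < n\<close> in auto)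
  finally have meeting: "real (card ?meeting) = (\<Prod>j = 1..n - t. Q ^ l - Q ^ j)" .
  have "card ((?through - ?meeting) \<union> (?within - ?between))
      = card (?through - ?meeting) + card (?within - ?between)"
    by (rule card_Un_disjoint) auto
  moreover have "Q ^ n = Q ^ (n - t) * Q ^ t"
    using \<open>t < n\<close> by (simp flip: power_add)
  moreover have "?meeting \<subseteq> ?through" "?between \<subseteq> ?within"
    by auto
  ultimately show ?thesis
    unfolding H1_eq_Un_Diff[OF X' M'(1) \<open>X \<subseteq> M\<close> \<open>t < n\<close>]
    using through meeting within between by (simp add: card_Diff algebra_simps)
qed

text \<open>Count the pairs \<open>(Y, F)\<close> of a hyperplane \<open>Y\<close> of \<open>Z\<close> and a member \<open>F \<supseteq> Y\<close>.\<close>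

lemma card_H2:
  assumes "has_type scale W (t + 2) 0 Z"
  shows "real (card (H2 t Z))
    = Q ^ (l * (n - t - 1)) * \<theta> (t + 2) - Q ^ (l * (n - t - 2) + 1) * \<theta> (t + 1)"
proof -
  let ?\<Y> = "subspaces_of_dim Z (t + 1)"
  have Z: "avoids_W Z" "subspace Z" "dim Z = Suc (t + 1)"
    using assms by (auto simp: has_type_0_iff avoids_W_def)
  have card_\<Y>: "real (card ?\<Y>) = \<theta> (t + 2)"
    using card_hyperplanes[OF Z(2,3)] by simp
  have H2_iff: "F \<in> H2 t Z \<longleftrightarrow> F \<in> complements"
    if "subspace Y" "Y \<subseteq> F" "Y \<subseteq> Z" "t + 1 \<le> dim Y" for Y F
    using that dim_subset[of Y "F \<inter> Z"] by (auto simp: H2_eq)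
  have below: "card {F \<in> H2 t Z. Y \<subseteq> F} = q ^ (l * (n - t - 1))" if Y: "Y \<in> ?\<Y>" for Y
  proof -
    have "{F \<in> H2 t Z. Y \<subseteq> F} = {F \<in> complements. Y \<subseteq> F}"
      using Y H2_iff by (auto simp: subspaces_of_dim_def)
    then show ?thesis
      using Y card_complements_through[of Y] avoids_W_subset[OF Z(1)]
      by (simp add: subspaces_of_dim_def)
  qed
  have above: "real (card {Y \<in> ?\<Y>. Y \<subseteq> F}) = 1 + (if Z \<subseteq> F then \<theta> (t + 2) - 1 else 0)"
    if "F \<in> H2 t Z" for F
    using that card_hyperplanes_within[OF Z(2,3), of F] complementsD(2) by (simp add: H2_eq)
  have "(\<Sum>Y\<in>?\<Y>. card {F \<in> H2 t Z. Y \<subseteq> F}) = (\<Sum>F\<in>H2 t Z. card {Y \<in> ?\<Y>. Y \<subseteq> F})"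
    by (intro sum_multicount_gen) auto
  then have "real (card ?\<Y>) * Q ^ (l * (n - t - 1)) = (\<Sum>F\<in>H2 t Z. real (card {Y \<in> ?\<Y>. Y \<subseteq> F}))"
    using below by (simp flip: of_nat_sum of_nat_mult of_nat_power)
  also have "\<dots> = (\<Sum>F\<in>H2 t Z. 1 + (if Z \<subseteq> F then \<theta> (t + 2) - 1 else 0))"
    using above by (rule sum.cong[OF refl])
  also have "\<dots> = real (card (H2 t Z)) + real (card {F \<in> H2 t Z. Z \<subseteq> F}) * (\<theta> (t + 2) - 1)"
    by (simp add: sum.distrib flip: sum.inter_filter)
  also have "{F \<in> H2 t Z. Z \<subseteq> F} = {F \<in> complements. Z \<subseteq> F}"
    using H2_iff[OF Z(2)] Z(3) by auto
  finally show ?thesis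
    using card_\<Y> card_complements_through[OF Z(1)] Z(3) theta_Suc'[of "t + 1"]
    by (simp add: algebra_simps)
qed

lemma obtain_maximal_intersecting_family:
  assumes "\<F> \<subseteq> complements" "t_intersecting scale t \<F>" "t \<le> n"
  obtains \<G> where "\<F> \<subseteq> \<G>" "\<G> \<subseteq> complements" "t_intersecting scale t \<G>"
    "\<And>A. A \<in> complements \<Longrightarrow> (\<And>B. B \<in> \<G> \<Longrightarrow> t \<le> dim (A \<inter> B)) \<Longrightarrow> A \<in> \<G>"
proof -
  let ?\<S> = "{\<G>. \<G> \<subseteq> complements \<and> t_intersecting scale t \<G>}"
  have "finite ?\<S>"
    by (rule finite_subset[of _ "Pow complements"]) auto
  then obtain \<G> where \<G>: "\<F> \<subseteq> \<G>" "\<G> \<subseteq> complements" "t_intersecting scale t \<G>"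
    and maximal: "\<And>\<H>. \<H> \<subseteq> complements \<Longrightarrow> t_intersecting scale t \<H> \<Longrightarrow> \<G> \<subseteq> \<H> \<Longrightarrow> \<G> = \<H>"
    using finite_has_maximal2[of ?\<S> \<F>] assms(1,2) by auto
  have "A \<in> \<G>" if A: "A \<in> complements" "\<And>B. B \<in> \<G> \<Longrightarrow> t \<le> dim (A \<inter> B)" for A
  proof -
    have "t_intersecting scale t (insert A \<G>)"
      using A \<G>(3) complementsD(3)[OF A(1)] assms(3)
      by (auto simp: t_intersecting_def Int_commute[of _ A])
    then have "\<G> = insert A \<G>"
      using A(1) \<G>(2) by (intro maximal) auto
    then show ?thesis by auto
  qed
  then show ?thesis
    using that \<G> by blast
qed

end

section \<open>Covers of an intersecting family\<close>

locale nontrivial_intersecting_family = attenuated_space +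
  fixes t :: nat and \<F> :: "'b set set"
  assumes family: "\<F> \<subseteq> complements"
    and intersecting: "t_intersecting scale t \<F>" and nontrivial: "nontrivial scale t \<F>"
    and t_le_n: "t \<le> n" and t_less_l: "t < l"
begin

definition cover :: "'b set \<Rightarrow> bool" where
  "cover T \<longleftrightarrow> avoids_W T \<and> (\<forall>F\<in>\<F>. t \<le> dim (T \<inter> F))"

definition cover_number :: nat where
  "cover_number = (LEAST d. \<exists>T. cover T \<and> dim T = d)"

definition minimal_covers :: "'b set set" where
  "minimal_covers = {T. cover T \<and> dim T = t + 1}"

lemma memberD:
  assumes "F \<in> \<F>"
  shows "avoids_W F" "subspace F" "dim F = n"
  using assms family complementsD by auto

lemma dim_Int_members: "A \<in> \<F> \<Longrightarrow> B \<in> \<F> \<Longrightarrow> t \<le> dim (A \<inter> B)"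
  using intersecting by (simp add: t_intersecting_def)

lemma not_subset_Inter:
  assumes "t \<le> dim X"
  obtains F where "F \<in> \<F>" "\<not> X \<subseteq> F"
proof -
  have "\<not> X \<subseteq> \<Inter>\<F>"
    using dim_subset[of X "\<Inter>\<F>"] nontrivial assms by (auto simp: nontrivial_def)
  then show ?thesis using that by blast
qed

lemma coverD:
  assumes "cover T"
  shows "avoids_W T" "subspace T" "F \<in> \<F> \<Longrightarrow> t \<le> dim (T \<inter> F)"
  using assms by (auto simp: cover_def avoids_W_def)

lemma minimal_coversD:
  assumes "T \<in> minimal_covers"
  shows "cover T" "subspace T" "dim T = t + 1"
  using assms coverD by (auto simp: minimal_covers_def)

lemma dim_cover_gt:
  assumes "cover T"
  shows "t < dim T"
proof -
  obtain F0 where "F0 \<in> \<F>"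
    using not_subset_Inter[of UNIV] t_le_n by (auto simp: dim_V)
  then have "t \<le> dim T"
    using coverD(3)[OF assms] dim_subset[of "T \<inter> F0" T] by force
  then obtain F where F: "F \<in> \<F>" "\<not> T \<subseteq> F"
    by (rule not_subset_Inter)
  have "subspace (T \<inter> F)"
    using coverD(2)[OF assms] memberD(2)[OF F(1)] by (rule subspace_inter)
  moreover have "T \<inter> F \<noteq> T"
    using F(2) by blast
  ultimately have "dim (T \<inter> F) < dim T"
    using subspace_dim_equal[of "T \<inter> F" T] coverD(2)[OF assms] by (auto simp: not_le)
  then show ?thesis
    using coverD(3)[OF assms F(1)] by simp
qed

lemma obtain_least_cover:
  obtains T where "cover T" "dim T = cover_number"
proof -
  obtain F where "F \<in> \<F>"
    using not_subset_Inter[of UNIV] t_le_n by (auto simp: dim_V)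
  then have "\<exists>d T. cover T \<and> dim T = d"
    using memberD(1) dim_Int_members by (auto simp: cover_def)
  then have "\<exists>T. cover T \<and> dim T = cover_number"
    unfolding cover_number_def by (rule LeastI_ex)
  then show ?thesis using that by blast
qed

lemma cover_number_le: "cover T \<Longrightarrow> cover_number \<le> dim T"
  unfolding cover_number_def by (rule Least_le) auto

lemma cover_number_bounds: "t < cover_number" "cover_number \<le> n"
  using obtain_least_cover dim_cover_gt dim_le_if_avoids_W coverD(1) by metis+

lemma card_members_through_le:
  assumes "subspace P"
  shows "real (card {F \<in> \<F>. P \<subseteq> F}) \<le> Q ^ (l * (n - dim P))"
proof (cases "avoids_W P")
  case True
  have "card {F \<in> \<F>. P \<subseteq> F} \<le> card {F \<in> complements. P \<subseteq> F}"
    using family by (intro card_mono) auto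
  then show ?thesis
    using card_complements_through[OF True] by (simp flip: of_nat_power)
next
  case False
  then have none: "{F \<in> \<F>. P \<subseteq> F} = {}"
    using avoids_W_subset[OF _ assms] memberD(1) by blast
  show ?thesis
    unfolding none by simp
qed

text \<open>Every member through \<open>X\<close> meets, outside \<open>X\<close>, a fixed member \<open>A\<close> with \<open>dim (X \<inter> A) < t\<close>.\<close>

lemma card_through_noncover_le:
  assumes X: "avoids_W X" "\<not> cover X" and "\<G> \<subseteq> \<F>" "0 \<le> b"
    and extension: "\<And>Y. avoids_W Y \<Longrightarrow> X \<subseteq> Y \<Longrightarrow> dim Y = dim X + 1 \<Longrightarrow>
      real (card {F \<in> \<G>. Y \<subseteq> F}) \<le> b"
  shows "real (card {F \<in> \<G>. X \<subseteq> F}) \<le> \<theta> (n - t + 1) * b"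
proof -
  have X': "subspace X"
    using X by (simp add: avoids_W_def)
  obtain A where A: "A \<in> \<F>" "dim (X \<inter> A) < t"
    using X by (auto simp: cover_def not_le)
  obtain V where V: "subspace V" "X \<subseteq> V" "dim V = dim X + (n - t + 1)"
    and outside: "\<And>F. subspace F \<Longrightarrow> t \<le> dim (F \<inter> A) \<Longrightarrow> \<not> F \<inter> V \<subseteq> X"
    using obtain_subspace_met_outside[OF X' memberD(2)[OF A(1)] A(2)] memberD(3)[OF A(1)] t_le_n
    by metis
  show ?thesis
  proof (rule card_le_mult_of_relation)
    show "real (card {Y \<in> subspaces_of_dim V (dim X + 1). X \<subseteq> Y}) \<le> \<theta> (n - t + 1)"
      using card_extensions[OF X' V(1,2)] V(3) by simp
    fix Y assume Y: "Y \<in> {Y \<in> subspaces_of_dim V (dim X + 1). X \<subseteq> Y}"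
    then have "{F \<in> {F \<in> \<G>. X \<subseteq> F}. Y \<subseteq> F} = {F \<in> \<G>. Y \<subseteq> F}"
      by auto
    moreover have "{F \<in> \<G>. Y \<subseteq> F} = {}" if "\<not> avoids_W Y"
      using that Y avoids_W_subset memberD(1) \<open>\<G> \<subseteq> \<F>\<close> by (auto simp: subspaces_of_dim_def)
    moreover have "real (card {F \<in> \<G>. Y \<subseteq> F}) \<le> b" if "avoids_W Y"
      using that Y by (intro extension) (auto simp: subspaces_of_dim_def)
    ultimately show "real (card {F \<in> {F \<in> \<G>. X \<subseteq> F}. Y \<subseteq> F}) \<le> b"
      using \<open>0 \<le> b\<close> by (metis card.empty of_nat_0)
  next
    fix F assume "F \<in> {F \<in> \<G>. X \<subseteq> F}"
    then have F: "F \<in> \<F>" "subspace F" "X \<subseteq> F"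
      using \<open>\<G> \<subseteq> \<F>\<close> memberD(2) by auto
    then obtain v where v: "v \<in> F" "v \<in> V" "v \<notin> X"
      using outside dim_Int_members[OF _ A(1)] by blast
    then have "span (insert v X) \<subseteq> F"
        "span (insert v X) \<in> {Y \<in> subspaces_of_dim V (dim X + 1). X \<subseteq> Y}"
      using F V X' subset_span_insert[of X v]
      by (simp_all add: subspaces_of_dim_def span_insert_subset_iff dim_insert)
    then show "\<exists>Y\<in>{Y \<in> subspaces_of_dim V (dim X + 1). X \<subseteq> Y}. Y \<subseteq> F"
      by blast
  qed (use \<open>0 \<le> b\<close> in auto)
qed

lemma card_through_le_if_covers_large:
  assumes "avoids_W X" "dim X \<le> j" "\<G> \<subseteq> \<F>"
    and large: "\<And>Y F. cover Y \<Longrightarrow> F \<in> \<G> \<Longrightarrow> Y \<subseteq> F \<Longrightarrow> j \<le> dim Y"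
  shows "real (card {F \<in> \<G>. X \<subseteq> F}) \<le> \<theta> (n - t + 1) ^ (j - dim X) * Q ^ (l * (n - j))"
  using assms(1,2)
proof (induction "j - dim X" arbitrary: X)
  case 0
  have "card {F \<in> \<G>. X \<subseteq> F} \<le> card {F \<in> \<F>. X \<subseteq> F}"
    using assms(3) by (intro card_mono) auto
  then show ?case
    using card_members_through_le[of X] 0 by (simp add: avoids_W_def)
next
  case (Suc d)
  let ?b = "\<theta> (n - t + 1) ^ d * Q ^ (l * (n - j))"
  have nonneg: "0 \<le> ?b"
    by (simp add: theta_nonneg)
  have "real (card {F \<in> \<G>. X \<subseteq> F}) \<le> \<theta> (n - t + 1) * ?b"
  proof (cases "cover X")
    case True
    then have none: "{F \<in> \<G>. X \<subseteq> F} = {}"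
      using large[of X] Suc.hyps(2) by fastforce
    show ?thesis
      unfolding none using nonneg theta_nonneg[of "n - t + 1"] by simp
  next
    case False
    show ?thesis
    proof (rule card_through_noncover_le[OF Suc.prems(1) False assms(3) nonneg])
      fix Y assume Y: "avoids_W Y" "dim Y = dim X + 1"
      then have "d = j - dim Y" "dim Y \<le> j"
        using Suc.hyps(2) by linarith+
      then show "real (card {F \<in> \<G>. Y \<subseteq> F}) \<le> ?b"
        using Suc.hyps(1)[of Y] Y(1) by simp
    qed
  qed
  also have "\<dots> = \<theta> (n - t + 1) ^ (j - dim X) * Q ^ (l * (n - j))"
    by (simp flip: Suc.hyps(2))
  finally show ?case .
qed

lemma card_le_if_covers_large:
  assumes "cover T" "dim T = t + k" "t \<le> j" "\<G> \<subseteq> \<F>"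
    and large: "\<And>Y F. cover Y \<Longrightarrow> F \<in> \<G> \<Longrightarrow> Y \<subseteq> F \<Longrightarrow> j \<le> dim Y"
  shows "real (card \<G>)
    \<le> gaussian_binomial (t + k) k * (\<theta> (n - t + 1) ^ (j - t) * Q ^ (l * (n - j)))"
proof (rule card_le_mult_of_relation)
  note T = coverD[OF assms(1)]
  show "real (card (subspaces_of_dim T t)) \<le> gaussian_binomial (t + k) k"
    using card_subspaces_of_codim[OF T(2) assms(2)] by simp
  show "real (card {F \<in> \<G>. S \<subseteq> F}) \<le> \<theta> (n - t + 1) ^ (j - t) * Q ^ (l * (n - j))"
    if "S \<in> subspaces_of_dim T t" for S
    using that card_through_le_if_covers_large[of S j \<G>] avoids_W_subset[OF T(1)] assms(3,4) large
    by (simp add: subspaces_of_dim_def)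
  fix F assume "F \<in> \<G>"
  then have "t \<le> dim (T \<inter> F)" "subspace (T \<inter> F)"
    using T memberD(2) assms(4) by (auto intro: subspace_inter)
  then obtain S where "subspace S" "S \<subseteq> T \<inter> F" "dim S = t"
    using choose_subspace_of_subspace[of t "T \<inter> F"] by auto
  then show "\<exists>S\<in>subspaces_of_dim T t. S \<subseteq> F"
    by (auto simp: subspaces_of_dim_def)
qed (simp_all add: theta_nonneg)

lemma card_le_cover_number:
  assumes "cover_number = t + k"
  shows "real (card \<F>) \<le> gaussian_binomial (t + k) k * \<theta> (n - t + 1) ^ k * Q ^ (l * (n - t - k))"
proof -
  obtain T where "cover T" "dim T = t + k"
    using obtain_least_cover assms by metis
  then have "real (card \<F>) \<le> gaussian_binomial (t + k) k
      * (\<theta> (n - t + 1) ^ (t + k - t) * Q ^ (l * (n - (t + k))))"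
    using cover_number_le assms by (intro card_le_if_covers_large) auto
  then show ?thesis
    by (simp add: mult.assoc)
qed

lemma card_le_minimal_covers:
  assumes "minimal_covers \<noteq> {}"
  shows "real (card \<F>) \<le> real (card minimal_covers) * Q ^ (l * (n - t - 1))
    + \<theta> (t + 1) * (\<theta> (n - t + 1))\<^sup>2 * Q ^ (l * (n - t - 2))"
proof -
  define \<A> where "\<A> = {F \<in> \<F>. \<exists>T\<in>minimal_covers. T \<subseteq> F}"
  define \<B> where "\<B> = {F \<in> \<F>. \<not> (\<exists>T\<in>minimal_covers. T \<subseteq> F)}"
  have "real (card \<A>) \<le> real (card minimal_covers) * Q ^ (l * (n - t - 1))"
  proof (rule card_le_mult_of_relation)
    fix T assume T: "T \<in> minimal_covers"
    have "card {F \<in> \<A>. T \<subseteq> F} \<le> card {F \<in> \<F>. T \<subseteq> F}"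
      by (rule card_mono) (auto simp: \<A>_def)
    then show "real (card {F \<in> \<A>. T \<subseteq> F}) \<le> Q ^ (l * (n - t - 1))"
      using card_members_through_le[of T] minimal_coversD[OF T] by simp
  qed (auto simp: \<A>_def)
  moreover have "real (card \<B>) \<le> \<theta> (t + 1) * (\<theta> (n - t + 1))\<^sup>2 * Q ^ (l * (n - t - 2))"
  proof -
    obtain T where T: "cover T" "dim T = t + 1"
      using assms by (auto simp: minimal_covers_def)
    have "t + 2 \<le> dim Y" if "cover Y" "F \<in> \<B>" "Y \<subseteq> F" for Y F
      using that dim_cover_gt[OF that(1)] by (force simp: \<B>_def minimal_covers_def)
    then have "real (card \<B>) \<le> gaussian_binomial (t + 1) 1
        * (\<theta> (n - t + 1) ^ (t + 2 - t) * Q ^ (l * (n - (t + 2))))"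
      by (intro card_le_if_covers_large[OF T]) (auto simp: \<B>_def)
    then show ?thesis
      by (simp add: mult.assoc)
  qed
  moreover have "card \<F> \<le> card \<A> + card \<B>"
  proof -
    have "\<F> = \<A> \<union> \<B>"
      by (auto simp: \<A>_def \<B>_def)
    then show ?thesis
      using card_Un_le[of \<A> \<B>] by simp
  qed
  ultimately show ?thesis by linarith
qed

lemma card_le_if_meets_W:
  assumes Z: "subspace Z" "dim Z = t + 2" "\<not> avoids_W Z"
    and T: "avoids_W T" "dim T = t + 1" "T \<subseteq> Z"
    and meet: "\<And>F. F \<in> \<F> \<Longrightarrow> t + 1 \<le> dim (F \<inter> Z)"
  shows "real (card \<F>) \<le> Q ^ (t + 1) * Q ^ (l * (n - t - 1))"
proof (rule card_le_mult_of_relation)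
  let ?\<Y> = "{Y \<in> subspaces_of_dim Z (t + 1). avoids_W Y}"
  have ZW: "subspace (Z \<inter> W)"
    using Z subspace_W by (intro subspace_inter)
  have "T \<inter> (Z \<inter> W) = {0}"
    using T by (auto simp: avoids_W_def)
  then have "dim (Z \<inter> W) \<le> 1"
    using dim_add_le_dim_Int[of T "Z \<inter> W" Z] T Z ZW by (simp add: avoids_W_def)
  moreover have "dim (Z \<inter> W) \<noteq> 0"
    using dim_eq_0_subspace[OF ZW] Z by (simp add: avoids_W_def)
  ultimately have dim_ZW: "dim (Z \<inter> W) = 1"
    by linarith
  have zero: "{0} \<inter> (Z \<inter> W) = {0}" "{0} \<subseteq> Z"
    using subspace_0[OF ZW] by auto
  have "Y \<in> ?\<Y> \<longleftrightarrow> Y \<in> complements_in Z (Z \<inter> W) \<and> {0} \<subseteq> Y" for Y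
  proof -
    have "Y \<inter> (Z \<inter> W) = Y \<inter> W" if "Y \<subseteq> Z"
      using that by blast
    then show ?thesis
      using Z(2) dim_ZW subspace_0[of Y]
      by (auto simp: subspaces_of_dim_def complements_in_def avoids_W_def)
  qed
  then have "?\<Y> = {Y \<in> complements_in Z (Z \<inter> W). {0} \<subseteq> Y}"
    by (simp only: set_eq_iff mem_Collect_eq simp_thms)
  then show "real (card ?\<Y>) \<le> Q ^ (t + 1)"
    using card_complements_containing[of Z "Z \<inter> W" "{0}"] zero Z ZW dim_ZW by simp
  show "real (card {F \<in> \<F>. Y \<subseteq> F}) \<le> Q ^ (l * (n - t - 1))" if "Y \<in> ?\<Y>" for Y
    using that card_members_through_le[of Y] by (auto simp: subspaces_of_dim_def)
  fix F assume F: "F \<in> \<F>"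
  have "subspace (F \<inter> Z)"
    using memberD(2)[OF F] Z(1) by (rule subspace_inter)
  then obtain Y where "subspace Y" "Y \<subseteq> F \<inter> Z" "dim Y = t + 1"
    using choose_subspace_of_subspace[OF meet[OF F]] by auto
  then show "\<exists>Y\<in>?\<Y>. Y \<subseteq> F"
    using avoids_W_subset[OF memberD(1)[OF F]] by (auto simp: subspaces_of_dim_def)
qed auto

lemma nonconcurrent_covers_cases:
  assumes pairwise: "\<And>T T'. T \<in> minimal_covers \<Longrightarrow> T' \<in> minimal_covers \<Longrightarrow> t \<le> dim (T \<inter> T')"
    and T: "T1 \<in> minimal_covers" "T2 \<in> minimal_covers" "T3 \<in> minimal_covers"
    and nonconcurrent: "T1 \<noteq> T2" "\<not> T1 \<inter> T2 \<subseteq> T3"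
  obtains
    (H2) Z where "has_type scale W (t + 2) 0 Z" "\<F> \<subseteq> H2 t Z"
  | (meets_W) "real (card \<F>) \<le> Q ^ (t + 1) * Q ^ (l * (n - t - 1))"
proof -
  note T1 = minimal_coversD[OF T(1)] and T2 = minimal_coversD[OF T(2)]
    and T3 = minimal_coversD[OF T(3)]
  let ?Z = "span (T1 \<union> T2)"
  have dim_Int: "dim (T1 \<inter> T2) = t"
    by (rule dim_Int_eq_if_neq) (use T1 T2 pairwise T nonconcurrent in auto)
  then have dim_Z: "dim ?Z = t + 2"
    using dim_Un_Int[OF T1(2) T2(2)] T1(3) T2(3) by simp
  have subset: "T1 \<subseteq> ?Z" "T2 \<subseteq> ?Z" "T3 \<subseteq> ?Z"
    using span_superset[of "T1 \<union> T2"]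
      subset_span_Un_if_meets_both[OF T1(2) T2(2) T3(2,3) dim_Int _ _ nonconcurrent(2)] pairwise T
    by auto
  have meet: "t + 1 \<le> dim (F \<inter> ?Z)" if F: "F \<in> \<F>" for F
    using dim_Int_gt_if_meets_three[OF T1(2) T2(2) T3(2) memberD(2)[OF F] subspace_span subset _ _ _
        dim_Int nonconcurrent(2)] coverD(3)[OF T1(1) F] coverD(3)[OF T2(1) F] coverD(3)[OF T3(1) F]
    by simp
  show ?thesis
  proof (cases "avoids_W ?Z")
    case True
    then show ?thesis
      using H2[of ?Z] dim_Z meet family by (auto simp: has_type_0_iff H2_eq)
  next
    case False
    show ?thesis
      using card_le_if_meets_W[OF subspace_span dim_Z False _ T1(3) subset(1)] coverD(1)[OF T1(1)]
        meet meets_W by blast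
  qed
qed

lemma minimal_cover_subset_span_Un:
  assumes X: "subspace X" "dim X = t" "X \<subseteq> T" and T: "T \<in> minimal_covers"
    and F: "F \<in> \<F>" "\<not> X \<subseteq> F"
  shows "T \<subseteq> span (X \<union> F)" "dim (span (X \<union> F)) = n + 1"
  using subset_span_Un_if_meets_hyperplane[of X T F] minimal_coversD[OF T] coverD(3)[OF _ F(1)]
    memberD[OF F(1)] X F(2) by auto

lemma card_minimal_covers_le:
  assumes X: "subspace X" "dim X = t" "\<forall>T\<in>minimal_covers. X \<subseteq> T"
    and "minimal_covers \<noteq> {}"
    and F: "F \<in> \<F>" "\<not> X \<subseteq> F" and F': "F' \<in> \<F>" "\<not> X \<subseteq> F'"
    and neq: "span (X \<union> F) \<noteq> span (X \<union> F')"
  shows "real (card minimal_covers) \<le> \<theta> (n - t)"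
proof -
  let ?D = "span (X \<union> F) \<inter> span (X \<union> F')"
  note covers = minimal_cover_subset_span_Un[OF X(1,2) X(3)[rule_format]]
  have D: "subspace ?D" "X \<subseteq> ?D"
    using span_superset[of "X \<union> F"] span_superset[of "X \<union> F'"] by (auto intro: subspace_inter)
  obtain T where T: "T \<in> minimal_covers"
    using \<open>minimal_covers \<noteq> {}\<close> by blast
  have "dim ?D < n + 1"
    using dim_Int_eq_if_neq[of "span (X \<union> F)" "span (X \<union> F')" n] neq
      covers(2)[OF T T F] covers(2)[OF T T F']
    by (cases "n \<le> dim ?D") auto
  have "Y \<in> {Y \<in> subspaces_of_dim ?D (dim X + 1). X \<subseteq> Y}" if "Y \<in> minimal_covers" for Y
    using that covers(1)[OF that that F] covers(1)[OF that that F'] minimal_coversD X(2,3)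
    by (simp add: subspaces_of_dim_def)
  then have "minimal_covers \<subseteq> {Y \<in> subspaces_of_dim ?D (dim X + 1). X \<subseteq> Y}"
    by (rule subsetI)
  then have "card minimal_covers \<le> card {Y \<in> subspaces_of_dim ?D (dim X + 1). X \<subseteq> Y}"
    by (intro card_mono) auto
  then have "real (card minimal_covers) \<le> \<theta> (dim ?D - t)"
    using card_extensions[OF X(1) D] X(2) by simp
  also have "\<dots> \<le> \<theta> (n - t)"
    using \<open>dim ?D < n + 1\<close> by (intro theta_mono) simp
  finally show ?thesis .
qed

lemma subset_H1:
  assumes M: "subspace M" "X \<subseteq> M"
    and F0: "F0 \<in> \<F>" "\<not> X \<subseteq> F0" "F0 \<subseteq> M"
    and within: "\<And>F. F \<in> \<F> \<Longrightarrow> \<not> X \<subseteq> F \<Longrightarrow> F \<subseteq> M"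
  shows "\<F> \<subseteq> H1 scale W n t X M"
proof
  fix F assume F: "F \<in> \<F>"
  show "F \<in> H1 scale W n t X M"
  proof (cases "X \<subseteq> F")
    case True
    have FF0: "subspace (F \<inter> F0)"
      using memberD(2)[OF F] memberD(2)[OF F0(1)] by (rule subspace_inter)
    have "t \<le> dim (F \<inter> F0)"
      using F F0(1) by (rule dim_Int_members)
    also have "\<dots> < dim (span (X \<union> F \<inter> F0))"
      using dim_less_dim_span_Un[OF FF0, of X] F0(2) by auto
    also have "span (X \<union> F \<inter> F0) \<subseteq> F \<inter> M"
      using True F0(3) M memberD(2)[OF F] by (intro span_minimal subspace_inter) auto
    then have "dim (span (X \<union> F \<inter> F0)) \<le> dim (F \<inter> M)"
      by (rule dim_subset)
    finally show ?thesis
      using True F family by (auto simp: H1_eq)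
  next
    case False
    then show ?thesis
      using F family within by (auto simp: H1_eq)
  qed
qed

lemma concurrent_covers_cases:
  assumes X: "subspace X" "dim X = t" "\<forall>T\<in>minimal_covers. X \<subseteq> T"
    and T: "T \<in> minimal_covers"
  obtains
    (H1) M where "has_type scale W (n + 1) 1 M" "X \<subseteq> M" "\<F> \<subseteq> H1 scale W n t X M"
  | (few_covers) "real (card minimal_covers) \<le> \<theta> (n - t)"
proof -
  obtain F0 where F0: "F0 \<in> \<F>" "\<not> X \<subseteq> F0"
    using not_subset_Inter[of X] X(2) by auto
  let ?M = "span (X \<union> F0)"
  have M: "dim ?M = n + 1" "X \<subseteq> ?M" "F0 \<subseteq> ?M"
    using minimal_cover_subset_span_Un(2)[OF X(1,2) X(3)[rule_format, OF T] T F0]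
      span_superset[of "X \<union> F0"] by auto
  show ?thesis
  proof (cases "\<forall>F\<in>\<F>. \<not> X \<subseteq> F \<longrightarrow> span (X \<union> F) = ?M")
    case True
    then have "F \<subseteq> ?M" if "F \<in> \<F>" "\<not> X \<subseteq> F" for F
      using that span_superset[of "X \<union> F"] by blast
    then have "\<F> \<subseteq> H1 scale W n t X ?M"
      using subset_H1[OF subspace_span M(2) F0 M(3)] by blast
    moreover have "dim (?M \<inter> W) = 1"
    proof -
      have "dim UNIV = dim (F0 \<union> W)"
        using dim_Un_Int[of F0 W] memberD[OF F0(1)] subspace_W
        by (simp add: avoids_W_def dim_W dim_V)
      also have "\<dots> \<le> dim (?M \<union> W)"
        using M(3) by (intro dim_subset) auto
      finally have "dim (?M \<union> W) = n + l"
        using dim_subset[of "?M \<union> W" UNIV] by (simp add: dim_V)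
      then show ?thesis
        using dim_Un_Int[OF subspace_span subspace_W, of "X \<union> F0"] M(1) by (simp add: dim_W)
    qed
    ultimately show ?thesis
      using H1[of ?M] M by (simp add: has_type_def)
  next
    case False
    then show ?thesis
      using card_minimal_covers_le[OF X _ _ _ F0] T few_covers by blast
  qed
qed

end

locale maximal_intersecting_family = nontrivial_intersecting_family +
  assumes maximal: "\<And>A. A \<in> complements \<Longrightarrow> (\<And>B. B \<in> \<F> \<Longrightarrow> t \<le> dim (A \<inter> B)) \<Longrightarrow> A \<in> \<F>"
begin

lemma dim_Int_minimal_covers:
  assumes T: "T \<in> minimal_covers" and T': "T' \<in> minimal_covers"
  shows "t \<le> dim (T \<inter> T')"
proof -
  note D = minimal_coversD[OF T] and D' = minimal_coversD[OF T']
  obtain F where F: "F \<in> complements" "T \<subseteq> F" "F \<inter> T' = T \<inter> T'"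
    using obtain_complement_in_general_position[OF coverD(1)[OF D(1)] D'(2)] D'(3) t_less_l by auto
  have "F \<in> \<F>"
  proof (rule maximal[OF F(1)])
    fix B assume "B \<in> \<F>"
    then have "t \<le> dim (T \<inter> B)"
      by (rule coverD(3)[OF D(1)])
    also have "\<dots> \<le> dim (F \<inter> B)"
      using F(2) by (intro dim_subset) auto
    finally show "t \<le> dim (F \<inter> B)" .
  qed
  then show ?thesis
    using coverD(3)[OF D'(1)] F(3) by (metis Int_commute)
qed

lemma minimal_covers_cases:
  assumes "minimal_covers \<noteq> {}"
  obtains
    (concurrent) X where "subspace X" "dim X = t" "\<forall>T\<in>minimal_covers. X \<subseteq> T"
  | (nonconcurrent) T1 T2 T3 where "T1 \<in> minimal_covers" "T2 \<in> minimal_covers" "T3 \<in> minimal_covers"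
      "T1 \<noteq> T2" "\<not> T1 \<inter> T2 \<subseteq> T3"
proof (cases "\<exists>T1\<in>minimal_covers. \<exists>T2\<in>minimal_covers. \<exists>T3\<in>minimal_covers. T1 \<noteq> T2 \<and> \<not> T1 \<inter> T2 \<subseteq> T3")
  case True
  then show ?thesis using nonconcurrent by blast
next
  case False
  have "\<exists>T1\<in>minimal_covers. \<exists>T2\<in>minimal_covers. \<forall>T\<in>minimal_covers. T1 \<inter> T2 \<subseteq> T"
    using False assms by (metis Int_absorb all_not_in_conv order_refl)
  then obtain T1 T2 where T: "T1 \<in> minimal_covers" "T2 \<in> minimal_covers"
    and common: "\<And>T. T \<in> minimal_covers \<Longrightarrow> T1 \<inter> T2 \<subseteq> T"
    by blast
  have "subspace (T1 \<inter> T2)"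
    using minimal_coversD(2) T by (intro subspace_inter)
  then obtain X where "subspace X" "X \<subseteq> T1 \<inter> T2" "dim X = t"
    using choose_subspace_of_subspace[OF dim_Int_minimal_covers[OF T]] by auto
  then show ?thesis
    using concurrent common by blast
qed

lemma maximal_family_cases:
  obtains
    (H2) Z where "has_type scale W (t + 2) 0 Z" "\<F> \<subseteq> H2 t Z"
  | (meets_W) "real (card \<F>) \<le> Q ^ (t + 1) * Q ^ (l * (n - t - 1))"
  | (H1) X M where "has_type scale W t 0 X" "has_type scale W (n + 1) 1 M" "X \<subseteq> M"
      "\<F> \<subseteq> H1 scale W n t X M"
  | (few_covers) "real (card \<F>) \<le> \<theta> (n - t) * Q ^ (l * (n - t - 1))
      + \<theta> (t + 1) * (\<theta> (n - t + 1))\<^sup>2 * Q ^ (l * (n - t - 2))"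
  | (large_covers) k where "2 \<le> k" "k \<le> n - t"
      "real (card \<F>) \<le> gaussian_binomial (t + k) k * \<theta> (n - t + 1) ^ k * Q ^ (l * (n - t - k))"
proof (cases "minimal_covers = {}")
  case True
  define k where "k = cover_number - t"
  obtain T where "cover T" "dim T = cover_number"
    by (rule obtain_least_cover)
  then have "cover_number \<noteq> t + 1"
    using True by (auto simp: minimal_covers_def)
  then have "2 \<le> k" "k \<le> n - t" "cover_number = t + k"
    using cover_number_bounds by (auto simp: k_def)
  then show ?thesis
    using card_le_cover_number large_covers by blast
next
  case False
  then obtain T where T: "T \<in> minimal_covers" by blast
  show ?thesis
    using False
  proof (cases rule: minimal_covers_cases)
    case (concurrent X)
    then have X: "has_type scale W t 0 X"
      using avoids_W_subset[OF coverD(1)[OF minimal_coversD(1)[OF T]]] T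
      by (simp add: has_type_0_iff)
    show ?thesis
      using concurrent T
    proof (cases rule: concurrent_covers_cases)
      case (H1 M)
      then show ?thesis using that(3) X by blast
    next
      case few_covers
      then have "real (card minimal_covers) * Q ^ (l * (n - t - 1))
          \<le> \<theta> (n - t) * Q ^ (l * (n - t - 1))"
        by (intro mult_right_mono) auto
      then show ?thesis
        using card_le_minimal_covers[OF False] that(4) by linarith
    qed
  next
    case (nonconcurrent T1 T2 T3)
    with dim_Int_minimal_covers show ?thesis
      by (cases rule: nonconcurrent_covers_cases) (use H2 meets_W in blast)+
  qed
qed

end

section \<open>Extremal families\<close>

lemma card_le_and_eq_iff_mem:
  fixes c :: real
  assumes "\<And>B. B \<in> \<E> \<Longrightarrow> finite B" "\<And>B. B \<in> \<E> \<Longrightarrow> real (card B) = c"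
    and "real (card A) < c \<or> (\<exists>B\<in>\<E>. A \<subseteq> B)"
  shows "real (card A) \<le> c \<and> (real (card A) = c \<longleftrightarrow> A \<in> \<E>)"
  using assms(3)
proof (elim disjE bexE)
  assume "real (card A) < c"
  then show ?thesis
    using assms(2)[of A] by auto
next
  fix B assume B: "B \<in> \<E>" "A \<subseteq> B"
  then have "card A \<le> card B" "card A = card B \<Longrightarrow> A = B"
    using assms(1) card_mono card_subset_eq by blast+
  then show ?thesis
    using B(1) assms(2)[OF B(1)] assms(2)[of A] by auto
qed

locale extremal_problem =
  nontrivial_intersecting_family scale Basis q W n l t \<F> + extremal_parameters q n l t
  for scale :: "'a::{field,finite} \<Rightarrow> 'b::ab_group_add \<Rightarrow> 'b" and Basis q W n l t \<F>
begin

definition H1_families :: "'b set set set" where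
  "H1_families = {\<H>. \<exists>X M. has_type scale W t 0 X \<and> has_type scale W (n + 1) 1 M \<and> X \<subseteq> M
    \<and> \<H> = H1 scale W n t X M}"

definition H2_families :: "'b set set set" where
  "H2_families = {\<H>. \<exists>Z. has_type scale W (t + 2) 0 Z \<and> \<H> = H2 t Z}"

lemma card_H1_families: "\<H> \<in> H1_families \<Longrightarrow> real (card \<H>) = H1_size"
  using card_H1 t_add_2_le_n by (auto simp: H1_families_def H1_size_def)

lemma card_H2_families: "\<H> \<in> H2_families \<Longrightarrow> real (card \<H>) = H2_size"
  using card_H2 by (auto simp: H2_families_def H2_size_def)

lemma extremal_or_small_cases:
  obtains
    (H1) \<H> where "\<H> \<in> H1_families" "\<F> \<subseteq> \<H>"
  | (H2) \<H> where "\<H> \<in> H2_families" "\<F> \<subseteq> \<H>"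
  | (meets_W) "real (card \<F>) \<le> Q ^ (t + 1) * N 1"
  | (small) "real (card \<F>) < threshold"
proof -
  obtain \<G> where \<G>: "\<F> \<subseteq> \<G>" "\<G> \<subseteq> complements" "t_intersecting scale t \<G>"
    and maximal: "\<And>A. A \<in> complements \<Longrightarrow> (\<And>B. B \<in> \<G> \<Longrightarrow> t \<le> dim (A \<inter> B)) \<Longrightarrow> A \<in> \<G>"
    using obtain_maximal_intersecting_family[OF family intersecting t_le_n] by blast
  have "nontrivial scale t \<G>"
    using nontrivial dim_subset[OF Inter_anti_mono[OF \<G>(1)]] by (simp add: nontrivial_def)
  then interpret closure: maximal_intersecting_family scale Basis q W n l t \<G>
    using \<G> maximal t_le_n t_less_l by unfold_locales auto
  have card_le: "real (card \<F>) \<le> real (card \<G>)"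
    using card_mono[OF _ \<G>(1)] by simp
  show ?thesis
  proof (cases rule: closure.maximal_family_cases)
    case (H2 Z)
    then show ?thesis
      using that(2)[of "H2 t Z"] \<G>(1) by (auto simp: H2_families_def)
  next
    case meets_W
    then show ?thesis
      using that(3) card_le by (simp add: N_def)
  next
    case (H1 X M)
    then show ?thesis
      using that(1)[of "H1 scale W n t X M"] \<G>(1) by (auto simp: H1_families_def)
  next
    case few_covers
    then show ?thesis
      using that(4) card_le few_covers_less_threshold by (simp add: N_def)
  next
    case (large_covers k)
    then show ?thesis
      using that(4) card_le cover_bound_less_threshold[of k] by (simp add: N_def cover_bound_def)
  qed
qed

theorem H1_families_extremal:
  assumes "t + 2 \<le> n - t"
  shows "real (card \<F>) \<le> H1_size \<and> (real (card \<F>) = H1_size \<longleftrightarrow> \<F> \<in> H1_families)"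
proof (rule card_le_and_eq_iff_mem[OF finite_vector_sets card_H1_families])
  show "real (card \<F>) < H1_size \<or> (\<exists>\<H>\<in>H1_families. \<F> \<subseteq> \<H>)"
  proof (cases rule: extremal_or_small_cases)
    case (H2 \<H>)
    then have "real (card \<F>) \<le> H2_size"
      using card_mono[of \<H> \<F>] card_H2_families by fastforce
    then show ?thesis
      using H2_size_less_H1_size[OF assms] by simp
  qed (use Q_power_mult_N_1_less_H1_size[OF assms] threshold_le_H1_size in auto)
qed

theorem H2_families_extremal:
  assumes "n - t \<le> t + 1"
  shows "real (card \<F>) \<le> H2_size \<and> (real (card \<F>) = H2_size \<longleftrightarrow> \<F> \<in> H2_families)"
proof (rule card_le_and_eq_iff_mem[OF finite_vector_sets card_H2_families])
  show "real (card \<F>) < H2_size \<or> (\<exists>\<H>\<in>H2_families. \<F> \<subseteq> \<H>)"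
  proof (cases rule: extremal_or_small_cases)
    case (H1 \<H>)
    then have "real (card \<F>) \<le> H1_size"
      using card_mono[of \<H> \<F>] card_H1_families by fastforce
    then show ?thesis
      using H1_size_less_H2_size[OF assms] by simp
  qed (use Q_power_mult_N_1_less_H2_size threshold_le_H2_size[OF assms] in auto)
qed

end

theorem theorem1p2:
  fixes scale :: "'a::{field,finite} \<Rightarrow> 'b::ab_group_add \<Rightarrow> 'b"
    and W :: "'b set" and \<F> :: "'b set set" and n l t q :: nat
  assumes "vector_space scale"
    and "q = CARD('a)"
    and "vector_space.dim scale (UNIV :: 'b set) = n + l"
    and "module.subspace scale W" and "vector_space.dim scale W = l"
    and "1 \<le> t" and "t + 2 \<le> n" and "n + t + 2 \<le> l"
    and "(l, q) \<noteq> (n + t + 2, 2)" and "(l, q) \<noteq> (n + t + 3, 2)"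
    and "\<F> \<subseteq> subspaces_of_type scale W UNIV n 0"
    and "t_intersecting scale t \<F>"
    and "nontrivial scale t \<F>"
  shows "(real t \<le> real n / 2 - 1 \<longrightarrow>
           real (card \<F>) \<le> real q ^ (l * (n - t)) - (\<Prod>j = 1..n - t. real q ^ l - real q ^ j)
                             + real q ^ (n - t) * (real q ^ t - 1) \<and>
           (real (card \<F>) = real q ^ (l * (n - t)) - (\<Prod>j = 1..n - t. real q ^ l - real q ^ j)
                             + real q ^ (n - t) * (real q ^ t - 1) \<longleftrightarrow>
            (\<exists>X M. has_type scale W t 0 X \<and>
                   has_type scale W (n + 1) 1 M \<and> X \<subseteq> M \<and>
                   \<F> = H1 scale W n t X M)))
       \<and> (real n / 2 - 1 / 2 \<le> real t \<longrightarrow>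
           real (card \<F>) \<le> real q ^ (l * (n - t - 1)) * theta q (t + 2)
                             - real q ^ (l * (n - t - 2) + 1) * theta q (t + 1) \<and>
           (real (card \<F>) = real q ^ (l * (n - t - 1)) * theta q (t + 2)
                             - real q ^ (l * (n - t - 2) + 1) * theta q (t + 1) \<longleftrightarrow>
            (\<exists>Z. has_type scale W (t + 2) 0 Z \<and>
                 \<F> = {F \<in> subspaces_of_type scale W UNIV n 0.
                        t + 1 \<le> vector_space.dim scale (F \<inter> Z)})))"
proof -
  interpret vector_space scale by fact
  obtain B where "B \<subseteq> UNIV" and B: "independent B" "UNIV \<subseteq> span B" "card B = dim UNIV"
    by (rule basis_exists)
  have "finite B"
    using B(3) assms(3,7) card_ge_0_finite[of B] by simp
  then interpret attenuated_space scale B q W n l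
    by unfold_locales (use B assms(2-5) in auto)
  interpret extremal_problem scale B q W n l t \<F>
    by unfold_locales (use assms(6-13) q_ge_2 in \<open>auto simp: subspaces_of_type_0_eq\<close>)
  have "real t \<le> real n / 2 - 1 \<Longrightarrow> t + 2 \<le> n - t" "real n / 2 - 1 / 2 \<le> real t \<Longrightarrow> n - t \<le> t + 1"
    by linarith+
  then show ?thesis
    using H1_families_extremal H2_families_extremal
    unfolding H1_size_def H1_families_def H2_size_def H2_families_def H2_def mem_Collect_eq
    by blast
qed

end
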